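(* Let $\mathbb{K}$ be a field and let $\mathcal{A}$ be an irreducible hyperplane arrangement in $V=\mathbb{K}^3$ (so $\ell=3$). Then the top degree term of $ST(\mathcal{A};x)=\Psi(\mathcal{A};x,-1)$ is $x^{|\mathcal{A}|}$.
   Context: An arrangement $\mathcal{A}$ in $V=\mathbb{K}^\ell$ is a finite set of linear hyperplanes (through the origin). It is irreducible if it is non-empty and cannot be written, after a linear change of coordinates, as a product $\mathcal{A}_1\times\mathcal{A}_2=\{H_1\times V_2\}_{H_1\in\mathcal{A}_1}\cup\{V_1\times H_2\}_{H_2\in\mathcal{A}_2}$ of (possibly empty) arrangements $\mathcal{A}_i$ in $V_i$ with $V=V_1\times V_2$, $\dim V_i>0$; in particular it is then essential, i.e. $\bigcap_{H\in\mathcal{A}}H=\{0\}$. Let $S=\mathbb{K}[x_1,\ldots,x_\ell]$ be the coordinate ring of $V$, and for $H\in\mathcal{A}$ fix a linear form $\alpha_H$ with $\ker\alpha_H=H$. Let $\mathrm{Der}\,S=\bigoplus_{i=1}^\ell S\,\partial_{x_i}$, graded with $\deg\partial_{x_i}=0$. For $0\le p\le\ell$ define the graded $S$-module $$D^p(\mathcal{A})=\{\theta\in\textstyle\bigwedge^p\mathrm{Der}\,S\mid \theta(\alpha_H,f_2,\ldots,f_p)\in S\alpha_H\ (\forall H\in\mathcal{A},\ \forall f_i\in S)\},\qquad D^0(\mathcal{A})=S,$$ where elements of $\bigwedge^p\mathrm{Der}\,S$ are regarded as alternating $p$-multiderivations of $S$. With $\mathrm{Hilb}(M;x)=\sum_k\dim_{\mathbb{K}}(M_k)x^k$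 the Hilbert series, the Solomon-Terao bi-polynomial is $$\Psi(\mathcal{A};x,t)=\sum_{p=0}^\ell\mathrm{Hilb}(D^p(\mathcal{A});x)\,(t(x-1)-1)^p,$$ which is known to lie in $\mathbb{Q}[x,t]$, and $ST(\mathcal{A};x)=\Psi(\mathcal{A};x,-1)=\sum_{p=0}^\ell\mathrm{Hilb}(D^p(\mathcal{A});x)(-x)^p$. *)

theory Defs
  imports
    "HOL-Analysis.Analysis"
    "HOL-Library.Poly_Mapping"
    "HOL-Library.Function_Algebras"
    "HOL-Combinatorics.Permutations"
    "HOL-Computational_Algebra.Polynomial_FPS"
begin

section \<open>Arrangements\<close>

definition hyperplane_in :: "('k::field ^ 'n) set \<Rightarrow> ('k ^ 'n) set \<Rightarrow> bool" where
  "hyperplane_in V H \<longleftrightarrow> vec.subspace H \<and> H \<subseteq> V \<and> vec.dim H + 1 = vec.dim V"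

definition arrangement_in :: "('k::field ^ 'n) set \<Rightarrow> ('k ^ 'n) set set \<Rightarrow> bool" where
  "arrangement_in V \<A> \<longleftrightarrow> finite \<A> \<and> (\<forall>H\<in>\<A>. hyperplane_in V H)"

definition coord_space :: "'n set \<Rightarrow> ('k::field ^ 'n) set" where
  "coord_space I = {v. \<forall>i. i \<notin> I \<longrightarrow> v $ i = 0}"

text \<open>The whole space is the product of \<open>coord_space I\<close> and \<open>coord_space (- I)\<close>; under this
  identification the product of subsets of the two factors is the set of all sums.\<close>

definition coord_times :: "('k::field ^ 'n) set \<Rightarrow> ('k ^ 'n) set \<Rightarrow> ('k ^ 'n) set" where
  "coord_times X Y = {v + w | v w. v \<in> X \<and> w \<in> Y}"

definition product_arrangement ::
    "'n set \<Rightarrow> ('k::field ^ 'n) set set \<Rightarrow> ('k ^ 'n) set set \<Rightarrow> ('k ^ 'n) set set" where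
  "product_arrangement I \<A>1 \<A>2 =
     (\<lambda>H1. coord_times H1 (coord_space (- I))) ` \<A>1 \<union>
     (\<lambda>H2. coord_times (coord_space I) H2) ` \<A>2"

definition irreducible_arrangement :: "('k::field ^ 'n) set set \<Rightarrow> bool" where
  "irreducible_arrangement \<A> \<longleftrightarrow> \<A> \<noteq> {} \<and>
     \<not> (\<exists>(P :: 'k ^ 'n ^ 'n) I \<A>1 \<A>2. invertible P \<and> I \<noteq> {} \<and> I \<noteq> UNIV \<and>
          arrangement_in (coord_space I) \<A>1 \<and> arrangement_in (coord_space (- I)) \<A>2 \<and>
          (\<lambda>H. (*v) P ` H) ` \<A> = product_arrangement I \<A>1 \<A>2)"


section \<open>The coordinate ring\<close>

text \<open>Polynomials over \<open>'k\<close> in variables indexed by \<open>'n\<close>: finitely supported coefficient functions on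
  exponent vectors, with convolution as multiplication.\<close>

type_synonym ('n, 'k) coord_ring = "('n \<Rightarrow>\<^sub>0 nat) \<Rightarrow>\<^sub>0 'k"

definition Const :: "'k::field \<Rightarrow> ('n, 'k) coord_ring" where
  "Const c = Poly_Mapping.single 0 c"

definition Var :: "'n \<Rightarrow> ('n, 'k::field) coord_ring" where
  "Var i = Poly_Mapping.single (Poly_Mapping.single i 1) 1"

definition homogeneous :: "nat \<Rightarrow> ('n::finite, 'k::field) coord_ring \<Rightarrow> bool" where
  "homogeneous k f \<longleftrightarrow> (\<forall>m\<in>Poly_Mapping.keys f. (\<Sum>i\<in>UNIV. Poly_Mapping.lookup m i) = k)"

text \<open>A linear form is given by its coefficient vector.\<close>

definition linear_form :: "'k::field ^ 'n \<Rightarrow> ('n::finite, 'k) coord_ring" where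
  "linear_form a = (\<Sum>i\<in>UNIV. Const (a $ i) * Var i)"

definition form_kernel :: "'k::field ^ 'n \<Rightarrow> ('k ^ 'n) set" where
  "form_kernel a = {v. (\<Sum>i\<in>UNIV. a $ i * v $ i) = 0}"

text \<open>In the summand of a monomial \<open>m\<close> without the variable \<open>i\<close> the exponent vector \<open>m - 1\<close> is
  truncated, but the coefficient is 0.\<close>

definition partial :: "'n \<Rightarrow> ('n, 'k::field) coord_ring \<Rightarrow> ('n, 'k) coord_ring" where
  "partial i f = (\<Sum>m\<in>Poly_Mapping.keys f.
     Poly_Mapping.single (m - Poly_Mapping.single i 1)
       (of_nat (Poly_Mapping.lookup m i) * Poly_Mapping.lookup f m))"


section \<open>Multiderivations\<close>

definition Der :: "(('n::finite, 'k::field) coord_ring \<Rightarrow> ('n, 'k) coord_ring) set" where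
  "Der = {\<lambda>f. \<Sum>i\<in>UNIV. g i * partial i f | g. True}"

text \<open>A \<open>p\<close>-ary map on the coordinate ring is encoded as a function of a sequence of arguments that
  depends only on the arguments with index \<open>0, \<dots>, p - 1\<close>.\<close>

type_synonym ('n, 'k) multimap = "(nat \<Rightarrow> ('n, 'k) coord_ring) \<Rightarrow> ('n, 'k) coord_ring"

definition sscale ::
    "('n, 'k::field) coord_ring \<Rightarrow> ('n, 'k) multimap \<Rightarrow> ('n, 'k) multimap" where
  "sscale g \<theta> = (\<lambda>f. g * \<theta> f)"

definition kscale :: "'k::field \<Rightarrow> ('n, 'k) multimap \<Rightarrow> ('n, 'k) multimap" where
  "kscale c = sscale (Const c)"

global_interpretation smod: module sscale
  by unfold_locales (auto simp: sscale_def fun_eq_iff algebra_simps)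

global_interpretation kvec: vector_space kscale
  by unfold_locales
    (auto simp: kscale_def sscale_def Const_def fun_eq_iff algebra_simps single_add mult_single
      simp flip: mult.assoc)

text \<open>The wedge product of \<open>p\<close> derivations as an alternating multiderivation: the determinant of the
  matrix with entries \<open>\<delta> i (f j)\<close>, without a factor \<open>1 / p!\<close>. For \<open>p = 0\<close> it is the constant 1.\<close>

definition wedge ::
    "nat \<Rightarrow> (nat \<Rightarrow> ('n, 'k::field) coord_ring \<Rightarrow> ('n, 'k) coord_ring) \<Rightarrow> ('n, 'k) multimap" where
  "wedge p \<delta> = (\<lambda>f. \<Sum>\<pi> | \<pi> permutes {..<p}. of_int (sign \<pi>) * (\<Prod>i<p. \<delta> i (f (\<pi> i))))"

definition ext_Der :: "nat \<Rightarrow> ('n::finite, 'k::field) multimap set" where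
  "ext_Der p = smod.span {wedge p \<delta> | \<delta>. \<forall>i<p. \<delta> i \<in> Der}"

text \<open>The grading in which the partial derivatives have degree 0.\<close>

definition ext_Der_degree :: "nat \<Rightarrow> nat \<Rightarrow> ('n::finite, 'k::field) multimap set" where
  "ext_Der_degree p k =
     kvec.span {sscale g (wedge p (\<lambda>i. partial (c i))) | g c. homogeneous k g}"

text \<open>\<open>\<alpha> H\<close> is the coefficient vector of the chosen linear form with kernel \<open>H\<close>. For \<open>p = 0\<close> there is
  no condition, and \<open>log_Der \<A> \<alpha> 0\<close> consists of the constants, i.e. it is the coordinate ring.\<close>

definition log_Der ::
    "('k::field ^ 'n) set set \<Rightarrow> (('k ^ 'n) set \<Rightarrow> 'k ^ 'n) \<Rightarrow> nat \<Rightarrow> ('n::finite, 'k) multimap set" where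
  "log_Der \<A> \<alpha> p = {\<theta> \<in> ext_Der p. p > 0 \<longrightarrow>
     (\<forall>H\<in>\<A>. \<forall>f. f 0 = linear_form (\<alpha> H) \<longrightarrow> linear_form (\<alpha> H) dvd \<theta> f)}"


section \<open>The Solomon-Terao polynomial\<close>

definition Hilb :: "(nat \<Rightarrow> ('n, 'k::field) multimap set) \<Rightarrow> rat fps" where
  "Hilb M = Abs_fps (\<lambda>k. of_nat (kvec.dim (M k)))"

definition Hilb_log_Der ::
    "('k::field ^ 'n) set set \<Rightarrow> (('k ^ 'n) set \<Rightarrow> 'k ^ 'n::finite) \<Rightarrow> nat \<Rightarrow> rat fps" where
  "Hilb_log_Der \<A> \<alpha> p = Hilb (\<lambda>k. log_Der \<A> \<alpha> p \<inter> ext_Der_degree p k)"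

text \<open>A polynomial in \<open>t\<close> whose coefficients are power series in \<open>x\<close>.\<close>

definition Solomon_Terao_bi ::
    "('k::field ^ 'n) set set \<Rightarrow> (('k ^ 'n) set \<Rightarrow> 'k ^ 'n::finite) \<Rightarrow> rat fps poly" where
  "Solomon_Terao_bi \<A> \<alpha> =
     (\<Sum>p\<le>CARD('n). smult (Hilb_log_Der \<A> \<alpha> p) ([: - 1, fps_X - 1 :] ^ p))"

definition Solomon_Terao ::
    "('k::field ^ 'n) set set \<Rightarrow> (('k ^ 'n) set \<Rightarrow> 'k ^ 'n::finite) \<Rightarrow> rat fps" where
  "Solomon_Terao \<A> \<alpha> = poly (Solomon_Terao_bi \<A> \<alpha>) (- 1)"

lemma Solomon_Terao_eq:
  fixes \<A> :: "('k::field ^ 'n::finite) set set"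
  shows "Solomon_Terao \<A> \<alpha> = (\<Sum>p\<le>CARD('n). Hilb_log_Der \<A> \<alpha> p * (- fps_X) ^ p)"
  by (simp add: Solomon_Terao_def Solomon_Terao_bi_def poly_sum)

end

theory Submission
  imports Defs
begin

text \<open>Write \<open>n\<close> for the number of planes, fix one of them, \<open>H0\<close>, with coefficient vector \<open>a0\<close> and linear
  form \<open>L0\<close>, and let \<open>F\<close> consist of the coefficient vectors of the other \<open>n - 1\<close> planes. In three
  variables a multiderivation is a vector of polynomials (degrees 1 and 2) or a single polynomial
  (degrees 0 and 3), and the logarithmic condition for the plane with coefficient vector \<open>b\<close> and
  linear form \<open>L\<close> becomes: \<open>L\<close> divides \<open>b \<bullet> g\<close> in degree 1, \<open>L\<close> divides every entry of \<open>g \<times> b\<close> in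
  degree 2, and \<open>L\<close> divides \<open>g\<close> in degree 3.

  Let \<open>D0\<close> be the module of logarithmic vector fields that annihilate \<open>L0\<close>. The Euler field \<open>E\<close>
  splits off: every logarithmic field is a multiple of \<open>E\<close> plus an element of \<open>D0\<close>, and the
  elements of degree 2 are the \<open>E \<times> h\<close> with \<open>h\<close> in \<open>D0\<close> plus the \<open>q a0\<close> with \<open>q\<close> divisible by the
  forms of all planes in \<open>F\<close>; the elements of degree 3 are the multiples of the product of all
  forms (\<open>dim_D1\<close>, \<open>dim_D2\<close>, \<open>dim_D3\<close>). If \<open>s\<close> and \<open>u\<close> are the Hilbert series of the polynomial
  ring and of \<open>D0\<close>, the Solomon-Terao series is therefore
  \<open>(1 - x^2) (s - x u + x^(n + 1) s)\<close>.

  So everything depends on the Hilbert function of \<open>D0\<close>, which for \<open>d \<ge> n - 3\<close> is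
  \<open>(d + 1) (d + 2) - (n - 1) (d + 1) + c\<close> for some constant \<open>c\<close> (\<open>dim_D0\<close>). Inserting this, the
  coefficients of the second factor are constant, say equal to \<open>\<gamma>\<close>, from \<open>x^(n - 1)\<close> on, and the
  coefficient of \<open>x^(n - 2)\<close> is \<open>\<gamma> - 1\<close>, since there the quadratic formula for \<open>s\<close> is evaluated one
  step outside its range. Multiplication with \<open>1 - x^2\<close> gives the coefficient 1 at \<open>x^n\<close> and 0 at
  all higher powers.

  The Hilbert function is computed by adding the planes of \<open>F\<close> one at a time; call those already
  added the older planes. The fields that stay logarithmic when the plane of \<open>a\<close> is added form the
  kernel of the map that sends \<open>g\<close> to the restriction of \<open>a \<bullet> g\<close> to this plane. A form on a plane is
  a polynomial in one variable \<open>t\<close>, the line where the plane meets \<open>H0\<close> being at infinity. The image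
  in large degree consists of all multiples, up to a degree bound, of \<open>B = \<Prod> (t - \<tau>)^(m \<tau> - 1)\<close>,
  where \<open>\<tau>\<close> runs over the lines in which the older planes meet the new one away from infinity, and
  \<open>m \<tau>\<close> counts the older planes through that line (\<open>image_\<rho>_value\<close>). Divisibility by \<open>B\<close> follows
  by comparing \<open>a\<close> with the older planes through each of these lines. Conversely, constant vectors in
  \<open>H0\<close>, multiplied with the forms of all older planes but at most one, produce all multiples of \<open>B\<close>
  up to the degree bound by Lagrange interpolation.\<close>

section \<open>Dimensions of subspaces\<close>

text \<open>The ambient spaces of polynomials and of multiderivations have infinite dimension, and \<open>dim\<close> is
  0 on infinite-dimensional subspaces, so finiteness has to be recorded separately.\<close>

definition fin_dim :: "('k::field \<Rightarrow> 'v::ab_group_add \<Rightarrow> 'v) \<Rightarrow> 'v set \<Rightarrow> bool" where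
  "fin_dim s V \<longleftrightarrow> (\<exists>B. finite B \<and> V \<subseteq> module.span s B)"

lemma fin_dim_subset: "fin_dim s W \<Longrightarrow> V \<subseteq> W \<Longrightarrow> fin_dim s V"
  by (auto simp: fin_dim_def)

lemma (in vector_space) fin_dim_zero: "fin_dim scale {0}"
  unfolding fin_dim_def by (rule exI[of _ "{}"]) auto

lemma (in vector_space) dim_zero: "dim {0} = 0"
  by (metis dim_eq_card_independent dim_span independent_empty card.empty span_empty)

lemma (in vector_space) finite_independent_if_fin_dim:
  assumes "fin_dim scale V" "B \<subseteq> V" "independent B"
  shows "finite B"
  using assms independent_span_bound unfolding fin_dim_def by blast

lemma (in vector_space) spans_of_disjoint_independent:
  assumes "independent B" "C \<subseteq> B" "D \<subseteq> B" "C \<inter> D = {}" "x \<in> span C" "x \<in> span D"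
  shows "x = 0"
proof -
  have "representation B x = representation C x" "representation B x = representation D x"
    using assms by (auto intro: representation_extend)
  hence "representation B x b = 0" for b
    using assms(4) representation_ne_zero[of C x b] representation_ne_zero[of D x b] by auto
  moreover have "x \<in> span B" using assms(2,5) span_mono by blast
  ultimately show ?thesis
    using sum_nonzero_representation_eq[OF assms(1), of x] by simp
qed

text \<open>A basis of the kernel is extended to a basis of \<open>V\<close>; the map is injective on the span of the added
  vectors.\<close>

lemma rank_nullity:
  assumes lin: "Vector_Spaces.linear s1 s2 f" and V: "module.subspace s1 V"
    and ker: "fin_dim s1 {v \<in> V. f v = 0}" and im: "fin_dim s2 (f ` V)"
  shows fin_dim_if_fin_dim_kernel_image: "fin_dim s1 V"
    and dim_eq_dim_kernel_plus_dim_image: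
      "vector_space.dim s1 V = vector_space.dim s1 {v \<in> V. f v = 0} + vector_space.dim s2 (f ` V)"
proof -
  interpret Vector_Spaces.linear s1 s2 f by (rule lin)
  interpret vector_space_pair s1 s2 by unfold_locales
  let ?K = "{v \<in> V. f v = 0}"
  obtain B0 where B0: "B0 \<subseteq> ?K" "vs1.independent B0" "?K \<subseteq> vs1.span B0"
    using vs1.maximal_independent_subset by blast
  obtain B where B: "B0 \<subseteq> B" "B \<subseteq> V" "vs1.independent B" "V \<subseteq> vs1.span B"
    using vs1.maximal_independent_subset_extend[of B0 V] B0 by blast
  define C where "C = B - B0"
  have BC: "B = B0 \<union> C" "B0 \<inter> C = {}" using B(1) by (auto simp: C_def)
  have CV: "vs1.span C \<subseteq> V"
    using B(2) V vs1.span_minimal[of C V] by (auto simp: C_def)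
  have inj: "inj_on f (vs1.span C)"
    unfolding inj_on_iff_eq_0[OF vs1.subspace_span]
  proof (intro ballI impI)
    fix x assume x: "x \<in> vs1.span C" "f x = 0"
    hence "x \<in> vs1.span B0" using CV B0(3) by blast
    thus "x = 0" using vs1.spans_of_disjoint_independent[OF B(3), of B0 C x] x BC by auto
  qed
  have ind: "vs2.independent (f ` C)"
    using inj vs1.independent_mono[OF B(3), of C] by (intro independent_injective_image) (auto simp: C_def)
  have fV: "f ` V \<subseteq> vs2.span (f ` C)"
  proof
    fix y assume "y \<in> f ` V"
    then obtain v where v: "v \<in> V" "y = f v" by blast
    then obtain a b where ab: "v = a + b" "a \<in> vs1.span B0" "b \<in> vs1.span C"
      using B(4) by (auto simp: BC(1) vs1.span_Un)
    have "vs1.subspace ?K" using V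
      by (auto simp: vs1.subspace_def add scale)
    hence "a \<in> ?K" using ab(2) vs1.span_minimal[OF B0(1)] by blast
    hence "y = f b" using v(2) ab(1) by (simp add: add)
    thus "y \<in> vs2.span (f ` C)" using ab(3) by (auto simp: span_image)
  qed
  have CV': "C \<subseteq> V" using B(2) by (auto simp: C_def)
  have finfC: "finite (f ` C)"
    by (rule vs2.finite_independent_if_fin_dim[OF im _ ind]) (use CV' in auto)
  have injC: "inj_on f C" using inj vs1.span_superset by (rule inj_on_subset)
  have finC: "finite C" using finfC injC finite_imageD by blast
  have finB0: "finite B0" by (rule vs1.finite_independent_if_fin_dim[OF ker B0(1,2)])
  show "fin_dim s1 V" using finC finB0 B(4) BC(1) by (auto simp: fin_dim_def)
  have "vs1.dim V = card B" using vs1.basis_card_eq_dim[OF B(2,4,3)] by simp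
  also have "\<dots> = card B0 + card C" using finC finB0 BC by (simp add: card_Un_disjoint)
  also have "card B0 = vs1.dim ?K" by (rule vs1.basis_card_eq_dim[OF B0(1,3,2)])
  also have "card C = card (f ` C)" by (rule card_image[OF injC, symmetric])
  also have "\<dots> = vs2.dim (f ` V)"
    by (rule vs2.basis_card_eq_dim[OF _ fV ind]) (use CV' in auto)
  finally show "vs1.dim V = vs1.dim ?K + vs2.dim (f ` V)" .
qed

lemma dim_image_inj_on:
  assumes lin: "Vector_Spaces.linear s1 s2 f" and V: "module.subspace s1 V"
    and inj: "\<And>v. v \<in> V \<Longrightarrow> f v = 0 \<Longrightarrow> v = 0"
  shows "vector_space.dim s2 (f ` V) = vector_space.dim s1 V"
proof -
  interpret Vector_Spaces.linear s1 s2 f by (rule lin)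
  interpret vector_space_pair s1 s2 by unfold_locales
  obtain B where B: "B \<subseteq> V" "vs1.independent B" "V \<subseteq> vs1.span B"
    using vs1.maximal_independent_subset by blast
  have sp: "vs1.span B = V" using B V vs1.span_minimal by blast
  have inj': "inj_on f V" using inj inj_on_iff_eq_0[OF V] by blast
  have "vs2.dim (f ` V) = card (f ` B)"
    by (rule vs2.basis_card_eq_dim[symmetric])
      (use B sp inj' independent_injective_image[of B] in \<open>auto simp: span_image\<close>)
  also have "\<dots> = card B" using inj' B(1) by (intro card_image) (rule inj_on_subset)
  also have "\<dots> = vs1.dim V" using vs1.basis_card_eq_dim[OF B(1,3,2)] by simp
  finally show ?thesis .
qed

lemma fin_dim_image:
  assumes lin: "Vector_Spaces.linear s1 s2 f" and "fin_dim s1 V"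
  shows "fin_dim s2 (f ` V)"
proof -
  interpret Vector_Spaces.linear s1 s2 f by (rule lin)
  obtain B where "finite B" "V \<subseteq> vs1.span B" using assms(2) by (auto simp: fin_dim_def)
  thus ?thesis unfolding fin_dim_def
    by (intro exI[of _ "f ` B"]) (auto simp: span_image)
qed

section \<open>Vectors with three entries over a commutative ring\<close>

text \<open>Scalar and vector product over an arbitrary commutative ring; they are needed both for vectors of
  scalars and for vectors of polynomials.\<close>

definition dot :: "'a::comm_ring_1 ^ 3 \<Rightarrow> 'a ^ 3 \<Rightarrow> 'a" where
  "dot x y = x $ 1 * y $ 1 + x $ 2 * y $ 2 + x $ 3 * y $ 3"

definition cross :: "'a::comm_ring_1 ^ 3 \<Rightarrow> 'a ^ 3 \<Rightarrow> 'a ^ 3" where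
  "cross x y = vector [x $ 2 * y $ 3 - x $ 3 * y $ 2, x $ 3 * y $ 1 - x $ 1 * y $ 3,
     x $ 1 * y $ 2 - x $ 2 * y $ 1]"

lemma cross_nth [simp]:
  "cross x y $ 1 = x $ 2 * y $ 3 - x $ 3 * y $ 2"
  "cross x y $ 2 = x $ 3 * y $ 1 - x $ 1 * y $ 3"
  "cross x y $ 3 = x $ 1 * y $ 2 - x $ 2 * y $ 1"
  by (simp_all add: cross_def)

lemma vec3_eq_iff: "(x :: 'a ^ 3) = y \<longleftrightarrow> x $ 1 = y $ 1 \<and> x $ 2 = y $ 2 \<and> x $ 3 = y $ 3"
  by (auto simp: vec_eq_iff forall_3)

lemma dot_commute: "dot x y = dot y x"
  by (simp add: dot_def algebra_simps)

lemma dot_linear: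
  "dot (x + y) z = dot x z + dot y z" "dot z (x + y) = dot z x + dot z y"
  "dot (c *s x) z = c * dot x z" "dot z (c *s x) = c * dot z x"
  "dot (x - y) z = dot x z - dot y z" "dot z (x - y) = dot z x - dot z y"
  "dot 0 z = 0" "dot z 0 = 0"
  by (simp_all add: dot_def algebra_simps)

lemma cross_linear:
  "cross (x + y) z = cross x z + cross y z" "cross z (x + y) = cross z x + cross z y"
  "cross (c *s x) z = c *s cross x z" "cross z (c *s x) = c *s cross z x"
  "cross 0 z = 0" "cross z 0 = 0"
  by (simp_all add: vec3_eq_iff algebra_simps)

lemma cross_self [simp]: "cross x x = 0"
  by (simp add: vec3_eq_iff algebra_simps)

lemma cross_commute: "cross x y = - cross y x"
  by (simp add: vec3_eq_iff algebra_simps)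

lemma dot_cross_self [simp]:
  "dot x (cross x y) = 0" "dot y (cross x y) = 0" "dot (cross x y) x = 0" "dot (cross x y) y = 0"
  by (simp_all add: dot_def algebra_simps)

lemma dot_cross_rotate: "dot x (cross y z) = dot y (cross z x)"
  by (simp add: dot_def algebra_simps)

lemma cross_cross: "cross (cross x y) z = dot x z *s y - dot y z *s x"
  by (simp add: vec3_eq_iff dot_def algebra_simps)

text \<open>Cramer's rule, for the coordinates of \<open>v\<close> in the basis \<open>x, y, z\<close>, and in its dual basis.\<close>

lemma cramer3:
  "dot x (cross y z) *s v = dot v (cross y z) *s x + dot v (cross z x) *s y + dot v (cross x y) *s z"
  by (simp add: vec3_eq_iff dot_def algebra_simps)

lemma cramer3_dual:
  "dot x (cross y z) *s v = dot v x *s cross y z + dot v y *s cross z x + dot v z *s cross x y"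
  by (simp add: vec3_eq_iff dot_def algebra_simps)

lemma proportional_if_cross_zero:
  fixes x y :: "'k::field ^ 3"
  assumes "cross x y = 0" "y \<noteq> 0"
  shows "\<exists>c. x = c *s y"
proof -
  from assms(2) obtain i where "y $ i \<noteq> 0" by (auto simp: vec_eq_iff)
  then show ?thesis using assms(1) exhaust_3[of i]
    by (intro exI[of _ "x $ i / y $ i"]) (auto simp: vec3_eq_iff field_simps)
qed

text \<open>If three planes share a line and the first two are distinct, the form of the third is a combination
  of the other two; the coefficients come from Cramer's rule.\<close>

lemma lin_comb_if_det_zero:
  fixes x y z :: "'k::field ^ 3"
  assumes "dot z (cross x y) = 0" "cross x y \<noteq> 0"
  shows "\<exists>c d. z = c *s x + d *s y"
proof -
  from assms(2) obtain i where i: "cross x y $ i \<noteq> 0" by (auto simp: vec_eq_iff)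
  have "cross x y $ i *s z = - (cross y z $ i) *s x - (cross z x $ i) *s y"
    using assms(1) exhaust_3[of i] 
    by (elim disjE) (auto simp: vec3_eq_iff dot_def algebra_simps)
  hence "z = (- (cross y z $ i) / cross x y $ i) *s x + (- (cross z x $ i) / cross x y $ i) *s y"
    using i by (auto simp: vec3_eq_iff field_simps)
  thus ?thesis by blast
qed

section \<open>Evaluation of polynomials\<close>

abbreviation "lookup \<equiv> Poly_Mapping.lookup"
abbreviation "keys \<equiv> Poly_Mapping.keys"

lemma coord_ring_expand:
  fixes f :: "('n, 'k::field) coord_ring"
  shows "f = (\<Sum>m\<in>keys f. Poly_Mapping.single m (lookup f m))"
proof (rule poly_mapping_eqI)
  fix k
  show "lookup f k = lookup (\<Sum>m\<in>keys f. Poly_Mapping.single m (lookup f m)) k"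
    by (simp add: lookup_sum lookup_single when_def not_in_keys_iff_lookup_eq_zero)
qed

lemma coord_ring_induct [case_names monomial add]:
  fixes f :: "('n, 'k::field) coord_ring"
  assumes "\<And>m c. P (Poly_Mapping.single m c)"
    and "\<And>f g. P f \<Longrightarrow> P g \<Longrightarrow> P (f + g)"
  shows "P f"
proof -
  have "P (\<Sum>m\<in>M. Poly_Mapping.single m (c m))" if "finite M" for M and c :: "_ \<Rightarrow> 'k"
    using that by (induction M) (use assms assms(1)[of 0 0] in auto)
  thus ?thesis by (subst coord_ring_expand) simp
qed

text \<open>Polynomials are evaluated at points of several commutative rings: at points of the field, at
  linear polynomials in one variable (restriction to a line), and at other polynomials.\<close>

locale coeff_hom =
  fixes h :: "'k::field \<Rightarrow> 'r::comm_ring_1"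
  assumes h_0: "h 0 = 0" and h_1: "h 1 = 1"
    and h_add: "\<And>a b. h (a + b) = h a + h b" and h_mult: "\<And>a b. h (a * b) = h a * h b"
begin

definition ev :: "('n::finite \<Rightarrow> 'r) \<Rightarrow> ('n, 'k) coord_ring \<Rightarrow> 'r" where
  "ev x f = (\<Sum>m\<in>keys f. h (lookup f m) * (\<Prod>i\<in>UNIV. x i ^ lookup m i))"

lemma ev_superset:
  assumes "finite M" "keys f \<subseteq> M"
  shows "ev x f = (\<Sum>m\<in>M. h (lookup f m) * (\<Prod>i\<in>UNIV. x i ^ lookup m i))"
  unfolding ev_def using assms
  by (intro sum.mono_neutral_left) (auto simp: h_0 not_in_keys_iff_lookup_eq_zero)

lemma ev_add: "ev x (f + g) = ev x f + ev x g"
proof -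
  have "keys (f + g) \<subseteq> keys f \<union> keys g" by (rule keys_add)
  thus ?thesis
    by (simp add: ev_superset[of "keys f \<union> keys g"] lookup_add h_add algebra_simps sum.distrib)
qed

lemma ev_single: "ev x (Poly_Mapping.single m c) = h c * (\<Prod>i\<in>UNIV. x i ^ lookup m i)"
  by (subst ev_superset[of "{m}"]) (auto simp: h_0)

lemma ev_0 [simp]: "ev x 0 = 0"
  by (simp add: ev_def)

lemma ev_mult: "ev x (f * g) = ev x f * ev x g"
proof (induction f rule: coord_ring_induct)
  case (monomial m c)
  show ?case
    by (induction g rule: coord_ring_induct)
      (simp_all add: mult_single ev_single h_mult lookup_add power_add prod.distrib distrib_left ev_add)
qed (simp add: ev_add distrib_right)

lemma ev_Const [simp]: "ev x (Const c) = h c"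
  by (simp add: Const_def ev_single)

lemma ev_1 [simp]: "ev x 1 = 1"
  using ev_Const[of x 1] by (simp add: Const_def h_1)

lemma ev_Var [simp]: "ev x (Var i) = x i"
proof -
  have "(\<Prod>j\<in>UNIV. x j ^ lookup (Poly_Mapping.single i 1) j) = (\<Prod>j\<in>UNIV. if j = i then x j else 1)"
    by (intro prod.cong) (auto simp: lookup_single when_def)
  thus ?thesis by (simp add: Var_def ev_single h_1)
qed

lemma ev_uminus: "ev x (- f) = - ev x f"
  using ev_add[of x f "- f"] by (simp add: add_eq_0_iff)

lemma ev_diff: "ev x (f - g) = ev x f - ev x g"
  using ev_add[of x f "- g"] by (simp add: ev_uminus)

lemma ev_sum: "ev x (\<Sum>i\<in>A. f i) = (\<Sum>i\<in>A. ev x (f i))"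
  by (induction A rule: infinite_finite_induct) (auto simp: ev_add)

lemma ev_prod: "ev x (\<Prod>i\<in>A. f i) = (\<Prod>i\<in>A. ev x (f i))"
  by (induction A rule: infinite_finite_induct) (auto simp: ev_mult)

lemma ev_power: "ev x (f ^ n) = ev x f ^ n"
  by (induction n) (auto simp: ev_mult)

lemma ev_linear_form: "ev x (linear_form a) = (\<Sum>i\<in>UNIV. h (a $ i) * x i)"
  by (simp add: linear_form_def ev_sum ev_mult)

lemmas ev_simps = ev_add ev_mult ev_diff ev_uminus ev_sum ev_prod ev_power
  ev_linear_form

lemma ev_dvd: "f dvd g \<Longrightarrow> ev x f dvd ev x g"
  by (auto simp: dvd_def ev_mult)

end

lemma Const_simps [simp]:
  "Const 0 = 0" "Const 1 = 1" "Const (a + b) = Const a + Const b" "Const (a * b) = Const a * Const b"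
  "Const (a - b) = Const a - Const b" "Const (- a) = - Const a"
  by (simp_all add: Const_def single_add mult_single single_diff single_uminus)

lemma Const_eq_0_iff [simp]: "Const c = 0 \<longleftrightarrow> c = 0"
  by (metis Const_def lookup_single_eq lookup_zero single_zero)

global_interpretation self: coeff_hom "Const :: 'k::field \<Rightarrow> ('n, 'k) coord_ring"
  defines substitute = self.ev
  by unfold_locales simp_all

global_interpretation scalar: coeff_hom "\<lambda>c :: 'k::field. c"
  defines point_value = scalar.ev
  by unfold_locales simp_all

global_interpretation univ: coeff_hom "\<lambda>c :: 'k::field. [:c:]"
  defines restrict_line = univ.ev
  by unfold_locales simp_all

global_interpretation scaled: coeff_hom "\<lambda>c :: 'k::field. [:Const c :: ('n, 'k) coord_ring:]"
  defines graded_value = scaled.ev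
  by unfold_locales simp_all

lemma prod_Var_powers:
  fixes m :: "'n::finite \<Rightarrow>\<^sub>0 nat"
  shows "(\<Prod>i\<in>UNIV. Var i ^ lookup m i) = (Poly_Mapping.single m 1 :: ('n, 'k::field) coord_ring)"
proof -
  have V: "Var i ^ n = (Poly_Mapping.single (Poly_Mapping.single i n) 1 :: ('n, 'k) coord_ring)" for i n
    by (induction n) (auto simp: Var_def mult_single simp flip: single_add)
  have "(\<Prod>i\<in>I. Var i ^ lookup m i) =
     (Poly_Mapping.single (\<Sum>i\<in>I. Poly_Mapping.single i (lookup m i)) 1 :: ('n, 'k) coord_ring)"
    if "finite I" for I using that
    by (induction I) (auto simp: V mult_single)
  moreover have "(\<Sum>i\<in>UNIV. Poly_Mapping.single i (lookup m i)) = m"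
    by (rule poly_mapping_eqI) (simp add: lookup_sum lookup_single when_def)
  ultimately show ?thesis by simp
qed

section \<open>Homogeneous polynomials and divisibility by linear forms\<close>

definition vars :: "('n::finite, 'k::field) coord_ring ^ 'n" where
  "vars = (\<chi> i. Var i)"

definition cvec :: "'k::field ^ 'n \<Rightarrow> ('n::finite, 'k) coord_ring ^ 'n" where
  "cvec a = (\<chi> i. Const (a $ i))"

lemma cvec_nth [simp]: "cvec a $ i = Const (a $ i)"
  by (simp add: cvec_def)

lemma vars_nth [simp]: "vars $ i = Var i"
  by (simp add: vars_def)

lemma linear_form_eq_dot: "linear_form a = dot (cvec a) vars"
  by (simp add: linear_form_def dot_def sum_3)

lemma dot_cvec: "dot (cvec a) (cvec b) = Const (dot a b)"
  by (simp add: dot_def)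

lemma cross_cvec: "cross (cvec a) (cvec b) = cvec (cross a b)"
  by (simp add: vec3_eq_iff)

lemma cvec_linear: "cvec (a + b) = cvec a + cvec b" "cvec (c *s a) = Const c *s cvec a"
  by (simp_all add: vec_eq_iff)

lemma linear_form_linear:
  "linear_form (a + b) = linear_form a + linear_form b"
  "linear_form (c *s a) = Const c * linear_form a" "linear_form 0 = 0"
  by (simp_all add: linear_form_def sum.distrib algebra_simps sum_distrib_left)

text \<open>The degree is an integer, so that degree shifts need no case distinction: there are no nonzero
  forms of negative degree.\<close>

definition forms :: "int \<Rightarrow> ('n::finite, 'k::field) coord_ring set" where
  "forms d = {f. \<forall>m\<in>keys f. int (\<Sum>i\<in>UNIV. lookup m i) = d}"

lemma homogeneous_iff_forms: "homogeneous k f \<longleftrightarrow> f \<in> forms (int k)"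
  by (auto simp: homogeneous_def forms_def simp flip: of_nat_sum)

lemma zero_in_forms [simp]: "0 \<in> forms d"
  by (simp add: forms_def)

lemma forms_add: "f \<in> forms d \<Longrightarrow> g \<in> forms d \<Longrightarrow> f + g \<in> forms d"
  using keys_add[of f g] unfolding forms_def by blast

lemma forms_single: "(\<Sum>i\<in>UNIV. lookup m i) = k \<Longrightarrow> d = int k \<Longrightarrow> Poly_Mapping.single m c \<in> forms d"
  by (auto simp: forms_def)

lemma forms_sum: "(\<And>i. i \<in> A \<Longrightarrow> f i \<in> forms d) \<Longrightarrow> (\<Sum>i\<in>A. f i) \<in> forms d"
  by (induction A rule: infinite_finite_induct) (auto simp: forms_add)

lemma forms_mult: "f \<in> forms d \<Longrightarrow> g \<in> forms e \<Longrightarrow> f * g \<in> forms (d + e)"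
proof -
  assume fg: "f \<in> forms d" "g \<in> forms e"
  show "f * g \<in> forms (d + e)" unfolding forms_def
  proof (intro CollectI ballI)
    fix m assume "m \<in> keys (f * g)"
    then obtain a b where "m = a + b" "a \<in> keys f" "b \<in> keys g" using keys_mult[of f g] by blast
    thus "int (\<Sum>i\<in>UNIV. lookup m i) = d + e"
      using fg by (auto simp: forms_def lookup_add sum.distrib)
  qed
qed

lemma Const_in_forms [simp]: "Const c \<in> forms 0"
  by (simp add: Const_def forms_single)

lemma one_in_forms [simp]: "1 \<in> forms 0"
  using Const_in_forms[of 1] by simp

lemma forms_Const_mult: "f \<in> forms d \<Longrightarrow> Const c * f \<in> forms d"
  using forms_mult[OF Const_in_forms] by fastforce

lemma forms_uminus: "f \<in> forms d \<Longrightarrow> - f \<in> forms d"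
  using forms_Const_mult[of f d "- 1"] by simp

lemma forms_diff: "f \<in> forms d \<Longrightarrow> g \<in> forms d \<Longrightarrow> f - g \<in> forms d"
  using forms_add[of f d "- g"] forms_uminus by auto

lemma Var_in_forms: "Var i \<in> forms 1"
  unfolding Var_def by (rule forms_single[of _ 1]) (simp_all add: lookup_single when_def)

lemma linear_form_in_forms: "linear_form a \<in> forms 1"
  unfolding linear_form_def by (intro forms_sum forms_Const_mult Var_in_forms)

lemma forms_prod: "finite A \<Longrightarrow> (\<And>i. i \<in> A \<Longrightarrow> f i \<in> forms 1) \<Longrightarrow> (\<Prod>i\<in>A. f i) \<in> forms (int (card A))"
  by (induction A rule: finite_induct) (auto dest!: forms_mult[of _ 1])

lemma forms_power: "f \<in> forms 1 \<Longrightarrow> f ^ n \<in> forms (int n)"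
  using forms_prod[of "{..<n}" "\<lambda>_. f"] by simp

lemma forms_negative:
  assumes "d < 0"
  shows "forms d = ({0} :: ('n::finite, 'k::field) coord_ring set)"
proof -
  have "keys f = {}" if "f \<in> forms d" for f :: "('n, 'k) coord_ring"
  proof (rule ccontr)
    assume "keys f \<noteq> {}"
    then obtain m where "m \<in> keys f" by blast
    hence "int (\<Sum>i\<in>UNIV. lookup m i) = d" using that unfolding forms_def by blast
    thus False using assms by (metis not_le of_nat_0_le_iff)
  qed
  thus ?thesis by auto
qed

text \<open>Scaling all variables by a new variable separates the homogeneous components. As this substitution
  is a ring homomorphism, factors of homogeneous polynomials can be compared degree by degree.\<close>

lemma graded_value_expand:
  fixes f :: "('n::finite, 'k::field) coord_ring"
  shows "graded_value (\<lambda>i. [:0, Var i:]) f =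
     (\<Sum>m\<in>keys f. monom (Poly_Mapping.single m (lookup f m)) (\<Sum>i\<in>UNIV. lookup m i))"
proof -
  have V: "[:0, c:] = monom c 1" for c :: "('n, 'k) coord_ring" by (simp add: monom_altdef)
  have *: "(\<Prod>i\<in>I. [:0, Var i :: ('n, 'k) coord_ring:] ^ m i) = monom (\<Prod>i\<in>I. Var i ^ m i) (\<Sum>i\<in>I. m i)"
    if "finite I" for I m using that
    by (induction I) (auto simp: V monom_power mult_monom)
  have "Const c * Poly_Mapping.single m 1 = Poly_Mapping.single m c" for c :: 'k and m :: "'n \<Rightarrow>\<^sub>0 nat"
    by (simp add: Const_def mult_single)
  thus ?thesis
    by (simp add: scaled.ev_def * prod_Var_powers smult_monom)
qed

lemma forms_iff_graded_value:
  "f \<in> forms (int d) \<longleftrightarrow> graded_value (\<lambda>i. [:0, Var i:]) f = monom f d"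
proof
  assume "f \<in> forms (int d)"
  hence *: "(\<Sum>i\<in>UNIV. lookup m i) = d" if "m \<in> keys f" for m
    using that unfolding forms_def by (metis (mono_tags, lifting) mem_Collect_eq of_nat_eq_iff)
  have "graded_value (\<lambda>i. [:0, Var i:]) f = (\<Sum>m\<in>keys f. monom (Poly_Mapping.single m (lookup f m)) d)"
    unfolding graded_value_expand by (intro sum.cong) (auto simp: *)
  also have "\<dots> = monom (\<Sum>m\<in>keys f. Poly_Mapping.single m (lookup f m)) d"
    by (rule poly_eqI) (auto simp: coeff_sum)
  finally show "graded_value (\<lambda>i. [:0, Var i:]) f = monom f d"
    using coord_ring_expand[of f] by simp
next
  assume eq: "graded_value (\<lambda>i. [:0, Var i:]) f = monom f d"
  show "f \<in> forms (int d)" unfolding forms_def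
  proof (intro CollectI ballI)
    fix m assume m: "m \<in> keys f"
    let ?e = "\<Sum>i\<in>UNIV. lookup m i"
    have "lookup (coeff (monom f d) ?e) m =
      (\<Sum>m'\<in>keys f. lookup (if (\<Sum>i\<in>UNIV. lookup m' i) = ?e then Poly_Mapping.single m' (lookup f m') else 0) m)"
      unfolding eq[symmetric] graded_value_expand by (simp add: coeff_sum lookup_sum)
    also have "\<dots> = (\<Sum>m'\<in>keys f. if m' = m then lookup f m else 0)"
      by (intro sum.cong) (auto simp: lookup_single when_def)
    also have "\<dots> = lookup f m" using m by simp
    finally have "lookup (if d = ?e then f else 0) m \<noteq> 0" using m by (simp add: in_keys_iff)
    thus "int ?e = int d" by (auto split: if_splits)
  qed
qed

lemma forms_cancel:
  fixes f g :: "('n::{finite, linorder}, 'k::field) coord_ring"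
  assumes f: "f \<in> forms (int e)" "f \<noteq> 0" and fg: "f * g \<in> forms d"
  shows "g \<in> forms (d - int e)"
proof (cases "g = 0")
  case False
  have "d \<ge> 0"
  proof (rule ccontr)
    assume "\<not> d \<ge> 0"
    hence "f * g = 0" using fg forms_negative[of d] by (metis not_le singletonD)
    thus False using f(2) False by simp
  qed
  then obtain k where k: "d = int k" using zero_le_imp_eq_int by blast
  let ?\<Phi> = "graded_value (\<lambda>i. [:0, Var i :: ('n, 'k) coord_ring:])"
  have "monom (f * g) k = ?\<Phi> (f * g)" using fg unfolding k forms_iff_graded_value by simp
  also have "\<dots> = monom f e * ?\<Phi> g" using f(1) unfolding forms_iff_graded_value by (simp add: scaled.ev_mult)
  finally have eq: "monom (f * g) k = monom f e * ?\<Phi> g" .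
  have "k \<ge> e"
  proof (rule ccontr)
    assume "\<not> k \<ge> e"
    hence "coeff (monom f e * ?\<Phi> g) k = 0" by (simp add: coeff_monom_mult)
    thus False using eq False f(2) by (metis coeff_monom mult_eq_0_iff)
  qed
  hence "monom f e * monom g (k - e) = monom (f * g) k"
    by (simp add: mult_monom)
  hence "monom f e * monom g (k - e) = monom f e * ?\<Phi> g" using eq by simp
  hence "?\<Phi> g = monom g (k - e)" using f(2) by simp
  hence "g \<in> forms (int (k - e))" by (simp only: forms_iff_graded_value)
  thus ?thesis using k \<open>k \<ge> e\<close> by (simp add: of_nat_diff)
qed simp

lemma dvd_substitute_diff:
  assumes "\<And>i. D dvd x i - Var i"
  shows "D dvd substitute x f - f"
proof (induction f rule: coord_ring_induct)
  case (monomial m c)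
  have pw: "D dvd x i ^ n - Var i ^ n" for i n
    by (rule dvd_trans[OF assms[of i]]) (simp add: power_diff_sumr2)
  have pr: "D dvd (\<Prod>i\<in>I. x i ^ lookup m i) - (\<Prod>i\<in>I. Var i ^ lookup m i)" if "finite I" for I
    using that
  proof (induction I)
    case (insert i I)
    have "(\<Prod>j\<in>insert i I. x j ^ lookup m j) - (\<Prod>j\<in>insert i I. Var j ^ lookup m j) =
       (x i ^ lookup m i - Var i ^ lookup m i) * (\<Prod>j\<in>I. x j ^ lookup m j) +
       Var i ^ lookup m i * ((\<Prod>j\<in>I. x j ^ lookup m j) - (\<Prod>j\<in>I. Var j ^ lookup m j))"
      using insert by (simp add: algebra_simps)
    thus ?case using insert pw by (simp add: dvd_add dvd_mult dvd_mult2 del: prod.insert)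
  qed auto
  have m: "Poly_Mapping.single m c = Const c * (\<Prod>i\<in>UNIV. Var i ^ lookup m i)"
    by (simp add: Const_def mult_single prod_Var_powers)
  have "substitute x (Poly_Mapping.single m c) - Poly_Mapping.single m c =
     Const c * ((\<Prod>i\<in>UNIV. x i ^ lookup m i) - (\<Prod>i\<in>UNIV. Var i ^ lookup m i))"
    by (subst self.ev_single, subst m) (simp add: right_diff_distrib)
  thus ?case using pr[of UNIV] by simp
next
  case (add f g)
  thus ?case using dvd_add[OF add] by (simp add: self.ev_add algebra_simps)
qed

text \<open>Modulo the linear form one variable can be eliminated, so divisibility is the vanishing of a ring
  homomorphism. In particular linear forms are prime.\<close>

lemma linear_form_dvd_iff:
  fixes a :: "'a::field ^ 'b::finite"
  assumes "a $ i \<noteq> 0"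
  shows "linear_form a dvd f \<longleftrightarrow>
    substitute (Var(i := Var i - Const (1 / a $ i) * linear_form a)) f = 0" (is "_ \<longleftrightarrow> substitute ?x f = 0")
proof
  have "substitute ?x (linear_form a) = (\<Sum>j\<in>UNIV. Const (a $ j) * Var j) +
     (\<Sum>j\<in>UNIV. if j = i then - (Const (a $ j) * (Const (1 / a $ j) * linear_form a)) else 0)"
    unfolding self.ev_linear_form sum.distrib[symmetric] by (intro sum.cong) (auto simp: algebra_simps)
  also have "\<dots> = linear_form a - Const (a $ i) * Const (1 / a $ i) * linear_form a"
    unfolding linear_form_def[of a, symmetric] by (simp add: algebra_simps)
  also have "Const (a $ i) * Const (1 / a $ i) = (1 :: ('b, 'a) coord_ring)"
    using assms by (subst Const_simps(4)[symmetric]) (simp del: Const_simps(4))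
  also have "linear_form a - 1 * linear_form a = 0" by simp
  finally have "substitute ?x (linear_form a) = 0" .
  thus "linear_form a dvd f \<Longrightarrow> substitute ?x f = 0"
    by (auto simp: dvd_def self.ev_mult)
next
  have "linear_form a dvd substitute ?x f - f"
    by (rule dvd_substitute_diff) auto
  thus "substitute ?x f = 0 \<Longrightarrow> linear_form a dvd f" by simp
qed

lemma linear_form_dvd_imp_point_value:
  assumes "linear_form a dvd f" "(\<Sum>i\<in>UNIV. a $ i * v $ i) = 0"
  shows "point_value (\<lambda>i. v $ i) f = 0"
proof -
  have "point_value (\<lambda>i. v $ i) (linear_form a) = 0" using assms(2) by (simp add: scalar.ev_linear_form)
  thus ?thesis using assms(1) by (auto simp: dvd_def scalar.ev_mult)
qed

lemma point_value_linear_form: "point_value (\<lambda>i. v $ i) (linear_form a) = dot a v"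
  by (simp add: scalar.ev_linear_form sum_3 dot_def)

text \<open>All vectors \<open>b \<times> v\<close> lie in the plane of \<open>b\<close>, hence are zeros of the form of \<open>a\<close>.\<close>

lemma cross_zero_if_linear_form_dvd:
  assumes "linear_form b dvd linear_form a"
  shows "cross a b = 0"
proof -
  have "dot a (cross b v) = 0" for v
  proof -
    have "point_value (\<lambda>i. cross b v $ i) (linear_form a) = 0"
      by (rule linear_form_dvd_imp_point_value[OF assms]) (simp add: sum_3 algebra_simps)
    thus ?thesis by (simp add: point_value_linear_form)
  qed
  hence "dot v (cross a b) = 0" for v by (metis dot_cross_rotate)
  from this[of "axis 1 1"] this[of "axis 2 1"] this[of "axis 3 1"] show ?thesis
    by (simp add: dot_def axis_def vec3_eq_iff)
qed

lemma linear_form_eq_0_iff [simp]: "linear_form a = 0 \<longleftrightarrow> a = 0" for a :: "'k::field ^ 'n::finite"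
proof
  assume *: "linear_form a = 0"
  have "a $ i = 0" for i
  proof -
    have "0 = point_value (\<lambda>j. axis i 1 $ j) (linear_form a)" by (simp add: *)
    also have "\<dots> = (\<Sum>j\<in>UNIV. if j = i then a $ j else 0)"
      unfolding scalar.ev_linear_form by (intro sum.cong) (auto simp: axis_def)
    finally show ?thesis by simp
  qed
  thus "a = 0" by (simp add: vec_eq_iff)
qed (simp add: linear_form_linear)

lemma prime_elem_linear_form:
  fixes a :: "'k::field ^ 'n::{finite, linorder}"
  assumes "a \<noteq> 0"
  shows "prime_elem (linear_form a)"
proof -
  from assms obtain i where i: "a $ i \<noteq> 0" by (auto simp: vec_eq_iff)
  show ?thesis unfolding prime_elem_def linear_form_dvd_iff[OF i]
    using assms by (auto simp: self.ev_mult)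
qed

lemma prod_dvd_if_prime_elems:
  fixes p :: "'i \<Rightarrow> 'a::idom"
  assumes "finite A" "\<And>i. i \<in> A \<Longrightarrow> prime_elem (p i)" "\<And>i. i \<in> A \<Longrightarrow> p i dvd x"
    and "\<And>i j. i \<in> A \<Longrightarrow> j \<in> A \<Longrightarrow> i \<noteq> j \<Longrightarrow> \<not> p i dvd p j"
  shows "(\<Prod>i\<in>A. p i) dvd x"
  using assms
proof (induction A rule: finite_induct)
  case (insert i A)
  then obtain y where y: "x = (\<Prod>j\<in>A. p j) * y" by (auto elim!: dvdE)
  have "\<not> p i dvd (\<Prod>j\<in>A. p j)"
  proof
    assume "p i dvd (\<Prod>j\<in>A. p j)"
    moreover have "prime_elem (p i)" using insert.prems(1) by blast
    ultimately have "\<exists>j\<in>A. p i dvd p j" using insert.hyps(1)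
    proof (induction A rule: infinite_finite_induct)
      case empty thus ?case by (simp add: prime_elem_def)
    next
      case (insert j B) thus ?case by (auto simp: prime_elem_dvd_mult_iff)
    qed auto
    thus False using insert.prems(3) insert.hyps(2) by blast
  qed
  moreover have "p i dvd (\<Prod>j\<in>A. p j) * y" using insert.prems(2) y by blast
  ultimately have "p i dvd y" using insert.prems(1) by (simp add: prime_elem_dvd_mult_iff)
  thus ?case using insert.hyps y by (simp add: mult.commute mult_dvd_mono)
qed auto

lemma prod_linear_forms_dvd:
  fixes F :: "('k::field ^ 3) set"
  assumes "finite F" "\<And>a. a \<in> F \<Longrightarrow> a \<noteq> 0" "\<And>a. a \<in> F \<Longrightarrow> linear_form a dvd f"
    and "\<And>a b. a \<in> F \<Longrightarrow> b \<in> F \<Longrightarrow> a \<noteq> b \<Longrightarrow> cross a b \<noteq> 0"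
  shows "(\<Prod>a\<in>F. linear_form a) dvd f"
proof (rule prod_dvd_if_prime_elems)
  fix a b assume "a \<in> F" "b \<in> F" "a \<noteq> b"
  thus "\<not> linear_form a dvd linear_form b"
    using assms(4)[of b a] cross_zero_if_linear_form_dvd by blast
qed (use assms in \<open>auto intro: prime_elem_linear_form\<close>)

section \<open>Restriction of forms to a plane\<close>

definition fscale :: "'k::field \<Rightarrow> ('n, 'k) coord_ring \<Rightarrow> ('n, 'k) coord_ring" where
  "fscale c f = Const c * f"

definition vscale :: "'k::field \<Rightarrow> ('n, 'k) coord_ring ^ 'm \<Rightarrow> ('n, 'k) coord_ring ^ 'm" where
  "vscale c g = Const c *s g"

global_interpretation fvec: vector_space fscale
  by unfold_locales (auto simp: fscale_def algebra_simps)

global_interpretation vvec: vector_space vscale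
  by unfold_locales (auto simp: vscale_def algebra_simps vec_eq_iff)

global_interpretation pvec: vector_space "smult :: 'k::field \<Rightarrow> _"
  by unfold_locales (auto simp: smult_add_left smult_add_right)

text \<open>The bound is on the coefficients and not on \<open>degree\<close>, as the zero polynomial has degree 0: for
  \<open>m \<le> 0\<close> this is the zero space.\<close>

definition deg_lt :: "int \<Rightarrow> 'k::field poly set" where
  "deg_lt m = {r. \<forall>i. coeff r i \<noteq> 0 \<longrightarrow> int i < m}"

lemma deg_lt_iff: "r \<in> deg_lt m \<longleftrightarrow> r = 0 \<or> int (degree r) < m"
proof
  assume "r \<in> deg_lt m"
  thus "r = 0 \<or> int (degree r) < m" unfolding deg_lt_def using leading_coeff_neq_0 by blast
next
  assume *: "r = 0 \<or> int (degree r) < m"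
  show "r \<in> deg_lt m" unfolding deg_lt_def
  proof (intro CollectI allI impI)
    fix i assume "coeff r i \<noteq> 0"
    thus "int i < m" using * le_degree[of r i] by auto
  qed
qed

lemma deg_lt_subspace: "pvec.subspace (deg_lt m)"
  unfolding pvec.subspace_def by (auto simp: deg_lt_def) (metis add.right_neutral)

lemma deg_lt_spanned:
  "deg_lt m = (pvec.span ((\<lambda>i. monom 1 i) ` {..<nat m}) :: 'k::field poly set)"
proof (rule subset_antisym)
  show "deg_lt m \<subseteq> (pvec.span ((\<lambda>i. monom 1 i) ` {..<nat m}) :: 'k poly set)"
  proof
    fix r :: "'k poly" assume r: "r \<in> deg_lt m"
    have eq: "r = (\<Sum>i\<le>degree r. smult (coeff r i) (monom 1 i))"
      by (simp add: smult_monom poly_as_sum_of_monoms)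
    have "(\<Sum>i\<le>degree r. smult (coeff r i) (monom 1 i)) \<in> pvec.span ((\<lambda>i. monom 1 i) ` {..<nat m})"
    proof (rule pvec.span_sum, goal_cases)
      case (1 i)
      show ?case
      proof (cases "coeff r i = 0")
        case False
        hence "monom 1 i \<in> (\<lambda>i. monom 1 i) ` {..<nat m}" using r by (auto simp: deg_lt_def)
        thus ?thesis by (intro pvec.span_scale pvec.span_base)
      qed (simp only: smult_0_left pvec.span_zero)
    qed
    thus "r \<in> pvec.span ((\<lambda>i. monom 1 i) ` {..<nat m})" using eq by (simp only: flip: eq)
  qed
  show "(pvec.span ((\<lambda>i. monom 1 i) ` {..<nat m}) :: 'k poly set) \<subseteq> deg_lt m"
    by (rule pvec.span_minimal[OF _ deg_lt_subspace]) (auto simp: deg_lt_def split: if_splits)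
qed

lemma fin_dim_deg_lt: "fin_dim smult (deg_lt m)"
  unfolding fin_dim_def deg_lt_spanned by (intro exI[of _ "(\<lambda>i. monom 1 i) ` {..<nat m}"]) auto

lemma dim_deg_lt: "pvec.dim (deg_lt m :: 'k::field poly set) = nat m"
proof -
  have inj: "inj_on (\<lambda>i. monom (1::'k) i) A" for A
    by (auto simp: inj_on_def monom_eq_iff')
  have "pvec.independent ((\<lambda>i. monom (1::'k) i) ` {..<nat m})"
  proof (rule pvec.independent_if_scalars_zero)
    fix f :: "'k poly \<Rightarrow> 'k" and x :: "'k poly"
    assume s: "(\<Sum>x\<in>(\<lambda>i. monom 1 i) ` {..<nat m}. smult (f x) x) = 0"
      and x: "x \<in> (\<lambda>i. monom 1 i) ` {..<nat m}"
    then obtain i where i: "i < nat m" "x = monom 1 i" by auto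
    have "0 = coeff (\<Sum>j<nat m. smult (f (monom 1 j)) (monom 1 j)) i"
      using s unfolding sum.reindex[OF inj] by (simp add: o_def)
    also have "\<dots> = f x" using i by (simp add: coeff_sum if_distrib[of "(*) _"] cong: if_cong)
    finally show "f x = 0" by simp
  qed auto
  from pvec.dim_span_eq_card_independent[OF this] show ?thesis
    unfolding deg_lt_spanned card_image[OF inj] by simp
qed

lemma forms_subspace: "fvec.subspace (forms d)"
  by (auto simp: fvec.subspace_def fscale_def forms_add forms_Const_mult)

text \<open>A basis of the space of linear forms that contains the forms \<open>a0\<close> of the fixed plane and \<open>a\<close> of
  the plane to which forms are restricted. In the dual basis \<open>p, q, w\<close> the vectors \<open>p\<close> and \<open>q\<close> span
  the plane of \<open>a\<close>, and \<open>q\<close> spans its intersection with the plane of \<open>a0\<close>.\<close>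

locale frame =
  fixes a0 \<nu> a :: "'k::field ^ 3"
  assumes det_frame: "dot a0 (cross \<nu> a) = 1"
begin

definition "p = cross \<nu> a"
definition "q = cross a a0"
definition "w = cross a0 \<nu>"

lemma dual_basis:
  "dot a0 p = 1" "dot a0 q = 0" "dot a0 w = 0"
  "dot \<nu> p = 0" "dot \<nu> q = 1" "dot \<nu> w = 0"
  "dot a p = 0" "dot a q = 0" "dot a w = 1"
  using det_frame dot_cross_rotate[of a0 \<nu> a] dot_cross_rotate[of \<nu> a a0]
  by (simp_all add: p_def q_def w_def)

lemma expand: "v = dot v p *s a0 + dot v q *s \<nu> + dot v w *s a"
  using cramer3[of a0 \<nu> a v] det_frame by (simp add: p_def q_def w_def)

lemma a_nonzero: "a \<noteq> 0"
  using dual_basis(9) by (auto simp: dot_linear)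

text \<open>A form on the plane of \<open>a\<close> is determined by its values \<open>f (p + t q)\<close>; the line spanned by \<open>q\<close> is
  at infinity.\<close>

definition \<rho> :: "(3, 'k) coord_ring \<Rightarrow> 'k poly" where
  "\<rho> = restrict_line (\<lambda>i. [:p $ i, q $ i:])"

lemma \<rho>_linear_form: "\<rho> (linear_form b) = [:dot b p, dot b q:]"
  by (simp add: \<rho>_def univ.ev_linear_form sum_3 dot_def)

lemma \<rho>_simps [simp]:
  "\<rho> 0 = 0" "\<rho> 1 = 1" "\<rho> (f + g) = \<rho> f + \<rho> g" "\<rho> (f - g) = \<rho> f - \<rho> g" "\<rho> (- f) = - \<rho> f"
  "\<rho> (f * g) = \<rho> f * \<rho> g" "\<rho> (Const c) = [:c:]" "\<rho> (f ^ n) = \<rho> f ^ n"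
  "\<rho> (\<Sum>i\<in>A. F i) = (\<Sum>i\<in>A. \<rho> (F i))" "\<rho> (\<Prod>i\<in>A. F i) = (\<Prod>i\<in>A. \<rho> (F i))"
  by (simp_all add: \<rho>_def univ.ev_simps)

lemma \<rho>_linear_form_a [simp]: "\<rho> (linear_form a) = 0"
  by (simp add: \<rho>_linear_form dual_basis)

lemma \<rho>_in_deg_lt:
  assumes "f \<in> forms d"
  shows "\<rho> f \<in> deg_lt (d + 1)"
proof -
  have "\<rho> (Poly_Mapping.single m (lookup f m)) \<in> deg_lt (d + 1)" if m: "m \<in> keys f" for m
  proof -
    have "degree (\<Prod>i\<in>UNIV. [:p $ i, q $ i:] ^ lookup m i) \<le> (\<Sum>i\<in>UNIV. lookup m i)"
    proof (rule order.trans[OF degree_prod_sum_le])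
      have "degree ([:p $ i, q $ i:] ^ n) \<le> n" for i n
        using degree_power_le[of "[:p $ i, q $ i:]" n] by (auto intro: order.trans)
      thus "sum (degree \<circ> (\<lambda>i. [:p $ i, q $ i:] ^ lookup m i)) UNIV \<le> sum (lookup m) UNIV"
        by (intro sum_mono) simp
    qed simp
    moreover have "degree (\<rho> (Poly_Mapping.single m (lookup f m))) \<le>
        degree (\<Prod>i\<in>UNIV. [:p $ i, q $ i:] ^ lookup m i)"
      using degree_smult_le by (simp add: \<rho>_def univ.ev_single)
    ultimately have "degree (\<rho> (Poly_Mapping.single m (lookup f m))) \<le> (\<Sum>i\<in>UNIV. lookup m i)"
      by (rule order.trans[rotated])
    moreover have "int (\<Sum>i\<in>UNIV. lookup m i) = d" using assms m unfolding forms_def by blast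
    ultimately show ?thesis unfolding deg_lt_iff by linarith
  qed
  hence "(\<Sum>m\<in>keys f. \<rho> (Poly_Mapping.single m (lookup f m))) \<in> deg_lt (d + 1)"
    by (intro pvec.subspace_sum[OF deg_lt_subspace])
  also have "(\<Sum>m\<in>keys f. \<rho> (Poly_Mapping.single m (lookup f m))) =
      \<rho> (\<Sum>m\<in>keys f. Poly_Mapping.single m (lookup f m))" by simp
  also have "\<dots> = \<rho> f" by (simp only: coord_ring_expand[symmetric])
  finally show ?thesis .
qed

text \<open>Homogenization inverts the restriction of forms of degree \<open>d\<close>, up to multiples of the form of \<open>a\<close>,
  since \<open>1\<close> and \<open>t\<close> are the restrictions of the forms of \<open>a0\<close> and \<open>\<nu>\<close>.\<close>

definition homog :: "nat \<Rightarrow> 'k poly \<Rightarrow> (3, 'k) coord_ring" where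
  "homog d r = (\<Sum>i\<le>d. Const (coeff r i) * linear_form a0 ^ (d - i) * linear_form \<nu> ^ i)"

lemma homog_in_forms: "homog d r \<in> forms (int d)"
  unfolding homog_def
proof (intro forms_sum)
  fix i assume "i \<in> {..d}"
  moreover have "linear_form a0 ^ (d - i) * linear_form \<nu> ^ i \<in> forms (int (d - i) + int i)"
    by (intro forms_mult forms_power linear_form_in_forms)
  ultimately show "Const (coeff r i) * linear_form a0 ^ (d - i) * linear_form \<nu> ^ i \<in> forms (int d)"
    unfolding mult.assoc by (intro forms_Const_mult) auto
qed

lemma \<rho>_homog:
  assumes "r \<in> deg_lt (int d + 1)"
  shows "\<rho> (homog d r) = r"
proof -
  have "\<rho> (homog d r) = (\<Sum>i\<le>d. monom (coeff r i) i)"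
    by (simp add: homog_def \<rho>_linear_form dual_basis monom_altdef flip: one_pCons)
  also have "\<dots> = r" using assms by (intro poly_as_sum_of_monoms') (auto simp: deg_lt_iff)
  finally show ?thesis .
qed

lemma image_\<rho>_forms: "\<rho> ` forms d = deg_lt (d + 1)"
proof (cases "d < 0")
  case True
  have "deg_lt (d + 1) = ({0} :: 'k poly set)" using True by (auto simp: deg_lt_iff)
  thus ?thesis using True by (simp add: forms_negative)
next
  case False
  then obtain k where "d = int k" using zero_le_imp_eq_int by (metis not_le)
  have "deg_lt (d + 1) \<subseteq> \<rho> ` forms d"
  proof
    fix r :: "'k poly" assume "r \<in> deg_lt (d + 1)"
    hence "r = \<rho> (homog k r)" using \<rho>_homog[of r k] \<open>d = int k\<close> by simp
    thus "r \<in> \<rho> ` forms d" using homog_in_forms[of k r] \<open>d = int k\<close> by blast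
  qed
  thus ?thesis using \<rho>_in_deg_lt by blast
qed

lemma homog_add: "homog d (r + s) = homog d r + homog d s"
  by (simp add: homog_def distrib_right sum.distrib)

lemma homog_smult: "homog d (smult c r) = Const c * homog d r"
  by (simp add: homog_def sum_distrib_left mult.assoc)

lemma homog_Suc:
  assumes "degree r \<le> d"
  shows "homog (Suc d) r = linear_form a0 * homog d r"
proof -
  have "homog (Suc d) r =
      (\<Sum>i\<le>d. Const (coeff r i) * linear_form a0 ^ (Suc d - i) * linear_form \<nu> ^ i)"
    using assms by (simp add: homog_def coeff_eq_0)
  also have "\<dots> = linear_form a0 * homog d r"
    unfolding homog_def sum_distrib_left
    by (intro sum.cong refl) (simp add: Suc_diff_le mult.commute mult.left_commute)
  finally show ?thesis .
qed

lemma homog_pCons: "homog (Suc d) (pCons 0 r) = linear_form \<nu> * homog d r"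
proof -
  have "homog (Suc d) (pCons 0 r) =
      (\<Sum>i\<le>d. Const (coeff r i) * linear_form a0 ^ (d - i) * linear_form \<nu> ^ Suc i)"
    unfolding homog_def by (subst sum.atMost_Suc_shift) simp
  also have "\<dots> = linear_form \<nu> * homog d r"
    unfolding homog_def sum_distrib_left
    by (intro sum.cong refl) (simp add: mult.commute mult.left_commute)
  finally show ?thesis .
qed

lemma homog_linear_mult:
  assumes "degree r \<le> d"
  shows "homog (Suc d) ([:c, e:] * r) = (Const c * linear_form a0 + Const e * linear_form \<nu>) * homog d r"
proof -
  have "[:c, e:] * r = smult c r + smult e (pCons 0 r)" by simp
  hence "homog (Suc d) ([:c, e:] * r) =
      Const c * homog (Suc d) r + Const e * homog (Suc d) (pCons 0 r)"
    by (simp only: homog_add homog_smult)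
  also have "\<dots> = (Const c * linear_form a0 + Const e * linear_form \<nu>) * homog d r"
    by (simp only: homog_pCons homog_Suc[OF assms] distrib_right mult.assoc)
  finally show ?thesis .
qed

lemma homog_prod:
  fixes x y :: "3 \<Rightarrow> 'k"
  assumes "finite I"
  shows "degree (\<Prod>i\<in>I. [:x i, y i:] ^ m i) \<le> (\<Sum>i\<in>I. m i) \<and>
    homog (\<Sum>i\<in>I. m i) (\<Prod>i\<in>I. [:x i, y i:] ^ m i) =
      (\<Prod>i\<in>I. (Const (x i) * linear_form a0 + Const (y i) * linear_form \<nu>) ^ m i)"
  using assms
proof (induction I)
  case empty
  show ?case by (simp add: homog_def)
next
  case (insert j I)
  define P d where "P = (\<Prod>i\<in>I. [:x i, y i:] ^ m i)" and "d = (\<Sum>i\<in>I. m i)"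
  define l L where "l = [:x j, y j:]" and "L = Const (x j) * linear_form a0 + Const (y j) * linear_form \<nu>"
  have l: "degree l \<le> 1" "degree r \<le> e \<Longrightarrow> homog (Suc e) (l * r) = L * homog e r" for r e
    using homog_linear_mult[of r e "x j" "y j"] by (simp_all add: l_def L_def)
  have P: "degree P \<le> d" using insert.IH by (simp add: P_def d_def)
  have "degree (l ^ n * P) \<le> n + d \<and> homog (n + d) (l ^ n * P) = L ^ n * homog d P" for n
  proof (induction n)
    case (Suc n)
    have "degree (l * (l ^ n * P)) \<le> Suc (n + d)"
      using Suc l(1) degree_mult_le[of l "l ^ n * P"] by linarith
    moreover have "homog (Suc (n + d)) (l * (l ^ n * P)) = L * (L ^ n * homog d P)"
      using Suc l(2) by metis
    ultimately show ?case by (simp add: mult.assoc)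
  qed (use P in simp)
  from this[of "m j"] insert show ?case
    unfolding P_def d_def l_def L_def by (simp only: prod.insert sum.insert) simp
qed

lemma substitute_eq_homog_\<rho>:
  assumes "f \<in> forms (int d)"
  shows "substitute (\<lambda>i. Const (p $ i) * linear_form a0 + Const (q $ i) * linear_form \<nu>) f = homog d (\<rho> f)"
    (is "substitute ?x f = _")
proof -
  have m: "substitute ?x (Poly_Mapping.single m c) = homog d (\<rho> (Poly_Mapping.single m c))"
    if m: "m \<in> keys f" for m c
  proof -
    have "int (\<Sum>i\<in>UNIV. lookup m i) = int d" using assms m unfolding forms_def by blast
    hence d: "(\<Sum>i\<in>UNIV. lookup m i) = d" by (simp only: of_nat_eq_iff)
    have "substitute ?x (Poly_Mapping.single m c) = Const c * (\<Prod>i\<in>UNIV. ?x i ^ lookup m i)"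
      by (rule self.ev_single)
    also have "(\<Prod>i\<in>UNIV. ?x i ^ lookup m i) = homog d (\<Prod>i\<in>UNIV. [:p $ i, q $ i:] ^ lookup m i)"
      using homog_prod[of UNIV "\<lambda>i. p $ i" "\<lambda>i. q $ i" "lookup m"] unfolding d by simp
    also have "Const c * \<dots> = homog d ([:c:] * (\<Prod>i\<in>UNIV. [:p $ i, q $ i:] ^ lookup m i))"
      by (simp add: homog_smult)
    also have "[:c:] * (\<Prod>i\<in>UNIV. [:p $ i, q $ i:] ^ lookup m i) = \<rho> (Poly_Mapping.single m c)"
      unfolding \<rho>_def by (rule univ.ev_single[symmetric])
    finally show ?thesis .
  qed
  have homog_sum: "homog d (\<Sum>i\<in>M. r i) = (\<Sum>i\<in>M. homog d (r i))" for M :: "(3 \<Rightarrow>\<^sub>0 nat) set" and r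
    by (induction M rule: infinite_finite_induct) (auto simp: homog_add, auto simp: homog_def)
  have "substitute ?x (\<Sum>m\<in>keys f. Poly_Mapping.single m (lookup f m)) =
      homog d (\<rho> (\<Sum>m\<in>keys f. Poly_Mapping.single m (lookup f m)))"
    by (simp add: self.ev_sum homog_sum m)
  thus ?thesis unfolding coord_ring_expand[of f, symmetric] .
qed

text \<open>Modulo the form of \<open>a\<close> every variable is a combination of the other two forms of the frame;
  substituting this combination into \<open>f\<close> gives the homogenization of \<open>\<rho> f\<close>.\<close>

lemma linear_form_dvd_if_\<rho>_zero:
  assumes "f \<in> forms d" "\<rho> f = 0"
  shows "linear_form a dvd f"
proof (cases "d < 0")
  case True
  hence "f = 0" using assms(1) forms_negative[OF True] by blast
  thus ?thesis by simp
next
  case False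
  then obtain k where k: "d = int k" using zero_le_imp_eq_int by (metis not_le)
  let ?x = "\<lambda>i. Const (p $ i) * linear_form a0 + Const (q $ i) * linear_form \<nu>"
  have "linear_form a dvd substitute ?x f - f"
  proof (rule dvd_substitute_diff)
    fix i
    have ax: "dot (axis i 1) v = v $ i" for v :: "'k ^ 3"
      using exhaust_3[of i] by (auto simp: dot_def axis_def)
    have "linear_form (axis i 1) = linear_form (p $ i *s a0 + q $ i *s \<nu> + w $ i *s a)"
      using arg_cong[OF expand[of "axis i 1"], of linear_form] unfolding ax .
    also have "\<dots> = ?x i + Const (w $ i) * linear_form a" by (simp only: linear_form_linear)
    also have "linear_form (axis i 1) = Var i"
      using exhaust_3[of i] by (auto simp: linear_form_def sum_3 axis_def)
    finally have "Var i = ?x i + Const (w $ i) * linear_form a" .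
    hence "?x i - Var i = - Const (w $ i) * linear_form a" by simp
    thus "linear_form a dvd ?x i - Var i" by simp
  qed
  moreover have "substitute ?x f = 0"
    using substitute_eq_homog_\<rho>[of f k] assms k by (simp add: homog_def)
  ultimately show ?thesis by simp
qed

lemma linear_form_dvd_iff_\<rho>: "f \<in> forms d \<Longrightarrow> linear_form a dvd f \<longleftrightarrow> \<rho> f = 0"
  using linear_form_dvd_if_\<rho>_zero by (auto simp: dvd_def)

lemma linear_\<rho>: "Vector_Spaces.linear fscale smult \<rho>"
  by (simp add: Vector_Spaces.linear_iff fscale_def fvec.vector_space_axioms pvec.vector_space_axioms)

end

lemma linear_form_cancel:
  fixes a :: "'k::field ^ 3"
  assumes "a \<noteq> 0" "linear_form a * g \<in> forms d"
  shows "g \<in> forms (d - 1)"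
  using forms_cancel[of "linear_form a" 1 g d] assms linear_form_in_forms[of a] by simp

text \<open>Restriction to a plane has kernel isomorphic to the forms of degree \<open>k - 1\<close> and image of dimension
  \<open>k + 1\<close>.\<close>

lemma dim_forms_aux:
  "fin_dim fscale (forms (int k - 1) :: (3, 'k::field) coord_ring set) \<and>
   2 * fvec.dim (forms (int k - 1) :: (3, 'k) coord_ring set) = k * (k + 1)"
proof (induction k)
  case 0
  show ?case by (simp add: forms_negative fvec.fin_dim_zero fvec.dim_zero)
next
  case (Suc k)
  interpret frame "axis 1 1 :: 'k ^ 3" "axis 2 1" "axis 3 1"
    by unfold_locales (simp add: dot_def axis_def)
  let ?a = "axis 3 1 :: 'k ^ 3"
  let ?V = "forms (int k) :: (3, 'k) coord_ring set"
  have mult: "Vector_Spaces.linear fscale fscale ((*) (linear_form ?a))"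
    by (simp add: Vector_Spaces.linear_iff fscale_def fvec.vector_space_axioms mult.left_commute distrib_left)
  have K: "{f \<in> ?V. \<rho> f = 0} = (*) (linear_form ?a) ` forms (int k - 1)"
  proof (intro subset_antisym subsetI)
    fix f assume f: "f \<in> {f \<in> ?V. \<rho> f = 0}"
    then obtain g where "f = linear_form ?a * g" using linear_form_dvd_if_\<rho>_zero[of f] by (blast elim: dvdE)
    moreover from this f have "g \<in> forms (int k - 1)"
      using linear_form_cancel[OF a_nonzero, of g "int k"] by simp
    ultimately show "f \<in> (*) (linear_form ?a) ` forms (int k - 1)" by blast
  next
    fix f assume "f \<in> (*) (linear_form ?a) ` forms (int k - 1)"
    then obtain g where "f = linear_form ?a * g" "g \<in> forms (int k - 1)" by blast
    thus "f \<in> {f \<in> ?V. \<rho> f = 0}"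
      using forms_mult[OF linear_form_in_forms[of ?a], of g "int k - 1"] by simp
  qed
  have fK: "fin_dim fscale {f \<in> ?V. \<rho> f = 0}"
    unfolding K using fin_dim_image[OF mult] Suc by blast
  have dK: "fvec.dim {f \<in> ?V. \<rho> f = 0} = fvec.dim (forms (int k - 1) :: (3, 'k) coord_ring set)"
    unfolding K by (rule dim_image_inj_on[OF mult forms_subspace]) (use a_nonzero in simp)
  have fI: "fin_dim smult (\<rho> ` ?V)" unfolding image_\<rho>_forms by (rule fin_dim_deg_lt)
  have "fin_dim fscale ?V"
    by (rule fin_dim_if_fin_dim_kernel_image[OF linear_\<rho> forms_subspace fK fI])
  moreover have "fvec.dim ?V = fvec.dim (forms (int k - 1) :: (3, 'k) coord_ring set) + (k + 1)"
    using dim_eq_dim_kernel_plus_dim_image[OF linear_\<rho> forms_subspace fK fI]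
    unfolding dK image_\<rho>_forms dim_deg_lt by simp
  ultimately show ?case using Suc by (simp add: algebra_simps)
qed

lemma fin_dim_forms: "fin_dim fscale (forms d :: (3, 'k::field) coord_ring set)"
proof (cases "d < 0")
  case False
  thus ?thesis using dim_forms_aux[of "nat (d + 1)", where 'k='k] by simp
qed (simp add: forms_negative fvec.fin_dim_zero)

lemma dim_forms:
  assumes "d \<ge> -2"
  shows "2 * int (fvec.dim (forms d :: (3, 'k::field) coord_ring set)) = (d + 1) * (d + 2)"
proof (cases "d = -2")
  case False
  define k where "k = nat (d + 1)"
  have k: "d = int k - 1" using False assms by (simp add: k_def)
  have "2 * fvec.dim (forms d :: (3, 'k) coord_ring set) = k * (k + 1)"
    using dim_forms_aux[of k] k by blast
  hence "2 * int (fvec.dim (forms d :: (3, 'k) coord_ring set)) = int (k * (k + 1))"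
    by (metis of_nat_mult of_nat_numeral)
  also have "\<dots> = (d + 1) * (d + 2)" by (simp add: k algebra_simps)
  finally show ?thesis .
qed (simp add: forms_negative fvec.dim_zero)

lemma dim_forms_negative: "d < 0 \<Longrightarrow> fvec.dim (forms d) = 0"
  by (simp add: forms_negative fvec.dim_zero)

section \<open>Logarithmic vector fields annihilating a linear form\<close>

lemma dot_cvec_in_forms: "(\<And>i. g $ i \<in> forms d) \<Longrightarrow> dot (cvec b) g \<in> forms d"
  unfolding dot_def cvec_nth by (intro forms_add forms_Const_mult)

lemma dvd_Const_mult_iff: "c \<noteq> 0 \<Longrightarrow> f dvd Const c * g \<longleftrightarrow> f dvd g"
proof
  assume c: "c \<noteq> 0" and f: "f dvd Const c * g"
  have "g = Const (1 / c * c) * g" using c by (simp del: Const_simps(4))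
  also have "\<dots> = Const (1 / c) * (Const c * g)" unfolding Const_simps(4) by (rule mult.assoc)
  finally show "f dvd g" using f by (metis dvd_mult)
qed simp

text \<open>A complement of the multiples of the Euler field in the logarithmic vector fields for the planes
  with coefficient vectors in \<open>insert a0 F\<close>.\<close>

definition D0 :: "'k::field ^ 3 \<Rightarrow> ('k ^ 3) set \<Rightarrow> int \<Rightarrow> ((3, 'k) coord_ring ^ 3) set" where
  "D0 a0 F d = {g. (\<forall>i. g $ i \<in> forms d) \<and> dot (cvec a0) g = 0 \<and>
     (\<forall>b\<in>F. linear_form b dvd dot (cvec b) g)}"

lemma D0_subspace: "vvec.subspace (D0 a0 F d)"
  by (auto simp: vvec.subspace_def vscale_def D0_def dot_linear intro: forms_add forms_Const_mult)

lemma D0_negative: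
  assumes "d < 0"
  shows "D0 a0 F d = {0}"
  using assms by (auto simp: D0_def forms_negative vec_eq_iff dot_linear)

lemma linear_dot: "Vector_Spaces.linear vscale fscale (\<lambda>g. dot x g)"
  by (simp add: Vector_Spaces.linear_iff fscale_def vscale_def fvec.vector_space_axioms vvec.vector_space_axioms dot_linear)

lemma linear_scaled_vector: "Vector_Spaces.linear fscale vscale (\<lambda>f. f *s x)"
  by (simp add: Vector_Spaces.linear_iff fscale_def vscale_def fvec.vector_space_axioms vvec.vector_space_axioms
      vec_eq_iff distrib_right mult.assoc)

context frame
begin

lemma cvec_expand_dual:
  "g = dot (cvec a0) g *s cvec p + dot (cvec \<nu>) g *s cvec q + dot (cvec a) g *s cvec w"
proof -
  have "dot (cvec a0) (cross (cvec \<nu>) (cvec a)) = 1"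
    by (simp add: cross_cvec dot_cvec det_frame)
  thus ?thesis
    using cramer3_dual[of "cvec a0" "cvec \<nu>" "cvec a" g]
    by (simp add: p_def q_def w_def cross_cvec dot_commute[of g])
qed

text \<open>A vector field annihilating the form of \<open>a0\<close> is a combination of the constant fields \<open>q\<close> and \<open>w\<close>
  with arbitrary coefficients.\<close>

lemma dim_D0_empty:
  "fin_dim vscale (D0 a0 {} d)" "vvec.dim (D0 a0 {} d) = 2 * fvec.dim (forms d :: (3, 'k) coord_ring set)"
proof -
  let ?V = "D0 a0 {} d" and ?f = "dot (cvec a)"
  have K: "{g \<in> ?V. ?f g = 0} = (\<lambda>f. f *s cvec q) ` forms d"
  proof (intro subset_antisym subsetI)
    fix g assume g: "g \<in> {g \<in> ?V. ?f g = 0}"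
    hence "g = dot (cvec \<nu>) g *s cvec q" using cvec_expand_dual[of g] by (simp add: D0_def)
    moreover have "dot (cvec \<nu>) g \<in> forms d" using g by (intro dot_cvec_in_forms) (auto simp: D0_def)
    ultimately show "g \<in> (\<lambda>f. f *s cvec q) ` forms d" by blast
  next
    fix g assume "g \<in> (\<lambda>f. f *s cvec q) ` forms d"
    then obtain f where f: "g = f *s cvec q" "f \<in> forms d" by blast
    have "f * Const c \<in> forms d" for c using forms_Const_mult[OF f(2), of c] by (simp add: mult.commute)
    thus "g \<in> {g \<in> ?V. ?f g = 0}"
      by (simp add: D0_def f(1) dot_linear dot_cvec dual_basis)
  qed
  have I: "?f ` ?V = forms d"
  proof (intro subset_antisym subsetI)
    fix f :: "(3, 'k) coord_ring" assume f: "f \<in> forms d"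
    have "f * Const c \<in> forms d" for c using forms_Const_mult[OF f, of c] by (simp add: mult.commute)
    hence "f *s cvec w \<in> ?V" by (simp add: D0_def dot_linear dot_cvec dual_basis)
    moreover have "?f (f *s cvec w) = f" by (simp add: dot_linear dot_cvec dual_basis)
    ultimately show "f \<in> ?f ` ?V" by force
  qed (auto simp: D0_def intro: dot_cvec_in_forms)
  have fK: "fin_dim vscale {g \<in> ?V. ?f g = 0}"
    unfolding K by (rule fin_dim_image[OF linear_scaled_vector fin_dim_forms])
  have dK: "vvec.dim {g \<in> ?V. ?f g = 0} = fvec.dim (forms d :: (3, 'k) coord_ring set)"
    unfolding K
  proof (rule dim_image_inj_on[OF linear_scaled_vector forms_subspace])
    fix f assume "f *s cvec q = 0"
    hence "dot (cvec \<nu>) (f *s cvec q) = 0" by (simp only: dot_linear)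
    thus "f = 0" by (simp add: dot_linear dot_cvec dual_basis)
  qed
  have fI: "fin_dim fscale (?f ` ?V)" unfolding I by (rule fin_dim_forms)
  show "fin_dim vscale ?V"
    by (rule fin_dim_if_fin_dim_kernel_image[OF linear_dot D0_subspace fK fI])
  show "vvec.dim ?V = 2 * fvec.dim (forms d :: (3, 'k) coord_ring set)"
    using dim_eq_dim_kernel_plus_dim_image[OF linear_dot D0_subspace fK fI] unfolding dK I by simp
qed

end

lemma prod_linear_powers_dvd:
  fixes x :: "'k::field poly"
  assumes "finite T" "\<And>\<tau>. \<tau> \<in> T \<Longrightarrow> [:-\<tau>, 1:] ^ e \<tau> dvd x"
  shows "(\<Prod>\<tau>\<in>T. [:-\<tau>, 1:] ^ e \<tau>) dvd x"
  using assms
proof (induction T rule: finite_induct)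
  case (insert \<sigma> T)
  let ?P = "\<Prod>\<tau>\<in>T. [:-\<tau>, 1:] ^ e \<tau>"
  obtain y where y: "x = ?P * y" using insert by (auto elim!: dvdE)
  have "poly ?P \<sigma> \<noteq> 0" using insert.hyps by (auto simp: poly_prod)
  hence o: "order \<sigma> ?P = 0" by (rule order_0I)
  have "[:-\<sigma>, 1:] ^ e \<sigma> dvd y"
  proof (cases "y = 0")
    case False
    have "x \<noteq> 0" using False y \<open>poly ?P \<sigma> \<noteq> 0\<close> by auto
    moreover have "[:-\<sigma>, 1:] ^ e \<sigma> dvd x" using insert.prems by blast
    ultimately have "e \<sigma> \<le> order \<sigma> x" by (simp add: order_divides)
    also have "order \<sigma> x = order \<sigma> y" using o order_mult[of ?P y \<sigma>] \<open>x \<noteq> 0\<close> unfolding y by simp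
    finally show ?thesis by (simp add: order_divides)
  qed simp
  thus ?case using insert.hyps by (simp add: y mult.commute mult_dvd_mono del: mult_pCons_left)
qed simp

text \<open>Lagrange interpolation at the points of \<open>T\<close>, with the remainder, which vanishes on \<open>T\<close>.\<close>

lemma lagrange_decomposition:
  fixes x :: "'k::field poly"
  assumes T: "finite T" and x: "x \<in> deg_lt m" and m: "int (card T) \<le> m"
  shows "\<exists>c s. x = (\<Prod>\<sigma>\<in>T. [:-\<sigma>, 1:]) * s + (\<Sum>\<tau>\<in>T. smult (c \<tau>) (\<Prod>\<sigma>\<in>T - {\<tau>}. [:-\<sigma>, 1:])) \<and>
           s \<in> deg_lt (m - int (card T))"
proof -
  define l where "l \<tau> = (\<Prod>\<sigma>\<in>T - {\<tau>}. [:-\<sigma>, 1:])" for \<tau> :: 'k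
  define R where "R = (\<Prod>\<sigma>\<in>T. [:-\<sigma>, 1:])"
  define c where "c \<tau> = poly x \<tau> / poly (l \<tau>) \<tau>" for \<tau>
  define y where "y = x - (\<Sum>\<tau>\<in>T. smult (c \<tau>) (l \<tau>))"
  have "poly (l \<tau>) \<tau> \<noteq> 0" for \<tau> using T by (auto simp: l_def poly_prod)
  moreover have "poly (l \<tau>) \<sigma> = 0" if "\<sigma> \<in> T" "\<sigma> \<noteq> \<tau>" for \<sigma> \<tau>
    using T that by (auto simp: l_def poly_prod)
  ultimately have *: "poly (smult (c \<tau>) (l \<tau>)) \<sigma> = (if \<tau> = \<sigma> then poly x \<sigma> else 0)" if "\<sigma> \<in> T" for \<sigma> \<tau>
    using that by (auto simp: c_def)
  have "poly y \<sigma> = 0" if "\<sigma> \<in> T" for \<sigma>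
    using T that by (simp add: y_def poly_sum *[OF that, simplified])
  hence "R dvd y" using prod_linear_powers_dvd[OF T, of "\<lambda>_. 1" y]
    by (simp add: R_def poly_eq_0_iff_dvd)
  then obtain s where s: "y = R * s" by (auto elim: dvdE)
  have "l \<tau> \<in> deg_lt m" if "\<tau> \<in> T" for \<tau>
  proof -
    have "degree (l \<tau>) = card (T - {\<tau>})" unfolding l_def by (subst degree_prod_eq_sum_degree) auto
    moreover have "card (T - {\<tau>}) < card T" using T that by (rule card_Diff1_less)
    ultimately show ?thesis using m by (auto simp: deg_lt_iff)
  qed
  hence y: "y \<in> deg_lt m" unfolding y_def
    by (intro pvec.subspace_diff[OF deg_lt_subspace] x pvec.subspace_sum[OF deg_lt_subspace]
        pvec.subspace_scale[OF deg_lt_subspace])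
  have R: "R \<noteq> 0" "degree R = card T" using T by (auto simp: R_def degree_prod_eq_sum_degree)
  have "s \<in> deg_lt (m - int (card T))"
    using y R by (cases "s = 0") (auto simp: s deg_lt_iff degree_mult_eq)
  moreover have "x = R * s + (\<Sum>\<tau>\<in>T. smult (c \<tau>) (l \<tau>))" by (simp add: s[symmetric] y_def)
  ultimately show ?thesis unfolding R_def l_def by blast
qed

text \<open>The plane of \<open>a\<close> is added to the planes of \<open>F\<close>. On the plane of \<open>a\<close> the planes of \<open>F\<close> cut out the
  lines through \<open>p + \<tau> q\<close> for \<open>\<tau>\<close> in \<open>T\<close> and, for those in \<open>Par\<close>, the line at infinity.\<close>

locale added_plane = frame a0 \<nu> a for a0 \<nu> a :: "'k::field ^ 3" +
  fixes F :: "('k ^ 3) set"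
  assumes finite_F: "finite F"
    and a0_F: "\<And>b. b \<in> F \<Longrightarrow> cross a0 b \<noteq> 0"
    and a_F: "\<And>b. b \<in> F \<Longrightarrow> cross a b \<noteq> 0"
    and pairwise_F: "\<And>b c. b \<in> F \<Longrightarrow> c \<in> F \<Longrightarrow> b \<noteq> c \<Longrightarrow> cross b c \<noteq> 0"
begin

definition "F_at \<tau> = {b \<in> F. poly (\<rho> (linear_form b)) \<tau> = 0}"
definition "T = {\<tau>. F_at \<tau> \<noteq> {}}"
definition "Par = {b \<in> F. dot b q = 0}"

lemma \<rho>_nonzero:
  assumes "b \<in> F"
  shows "\<rho> (linear_form b) \<noteq> 0"
proof
  assume "\<rho> (linear_form b) = 0"
  hence "b = dot b w *s a" using expand[of b] by (simp add: \<rho>_linear_form)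
  hence "cross a b = 0" by (metis cross_linear(4) cross_self vector_smult_rzero)
  thus False using a_F[OF assms] by simp
qed

lemma F_nonzero: "b \<in> F \<Longrightarrow> b \<noteq> 0"
  using a_F[of b] by (auto simp: cross_linear)

lemma F_at_iff: "b \<in> F_at \<tau> \<longleftrightarrow> b \<in> F \<and> dot b q \<noteq> 0 \<and> \<rho> (linear_form b) = smult (dot b q) [:-\<tau>, 1:]"
proof
  assume b: "b \<in> F_at \<tau>"
  hence "dot b p + \<tau> * dot b q = 0" by (simp add: F_at_def \<rho>_linear_form)
  hence p: "dot b p = - \<tau> * dot b q" by (simp add: eq_neg_iff_add_eq_0)
  have "dot b q \<noteq> 0" using \<rho>_nonzero[of b] b p by (auto simp: F_at_def \<rho>_linear_form)
  thus "b \<in> F \<and> dot b q \<noteq> 0 \<and> \<rho> (linear_form b) = smult (dot b q) [:-\<tau>, 1:]"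
    using b p by (simp add: F_at_def \<rho>_linear_form)
qed (auto simp: F_at_def)

lemma F_at_finite: "finite (F_at \<tau>)"
  using finite_F by (simp add: F_at_def)

lemma F_at_disjoint: "\<sigma> \<noteq> \<tau> \<Longrightarrow> F_at \<sigma> \<inter> F_at \<tau> = {}"
  by (auto simp: F_at_iff)

lemma F_decompose: "F = Par \<union> (\<Union>\<tau>\<in>T. F_at \<tau>)" "Par \<inter> (\<Union>\<tau>\<in>T. F_at \<tau>) = {}"
proof -
  have "b \<in> F_at (- dot b p / dot b q)" if "b \<in> F" "dot b q \<noteq> 0" for b
    using that by (simp add: F_at_def \<rho>_linear_form)
  thus "F = Par \<union> (\<Union>\<tau>\<in>T. F_at \<tau>)" by (fastforce simp: Par_def T_def F_at_def)
  show "Par \<inter> (\<Union>\<tau>\<in>T. F_at \<tau>) = {}" by (auto simp: Par_def F_at_iff)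
qed

lemma T_finite: "finite T"
proof -
  have "finite (\<Union>b\<in>F. {\<tau>. poly (\<rho> (linear_form b)) \<tau> = 0})"
    using finite_F \<rho>_nonzero by (intro finite_UN_I poly_roots_finite)
  moreover have "T \<subseteq> (\<Union>b\<in>F. {\<tau>. poly (\<rho> (linear_form b)) \<tau> = 0})" by (auto simp: T_def F_at_def)
  ultimately show ?thesis by (rule rev_finite_subset)
qed

lemma card_F_at_pos: "\<tau> \<in> T \<Longrightarrow> card (F_at \<tau>) \<ge> 1"
  using F_at_finite[of \<tau>] by (auto simp: T_def Suc_le_eq card_gt_0_iff)

text \<open>The image of the restriction map will consist of multiples of \<open>B\<close>, and \<open>B R\<close> is the restriction of the
  product of all forms of \<open>F\<close>.\<close>

definition "scaling = (\<Prod>b\<in>Par. dot b p) * (\<Prod>\<tau>\<in>T. \<Prod>b\<in>F_at \<tau>. dot b q)"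
definition "B = smult scaling (\<Prod>\<tau>\<in>T. [:-\<tau>, 1:] ^ (card (F_at \<tau>) - 1))"
definition "R = (\<Prod>\<tau>\<in>T. [:-\<tau>, 1:])"

lemma Par_finite: "finite Par"
  using finite_F by (simp add: Par_def)

lemma \<rho>_Par: "(\<Prod>b\<in>Par. \<rho> (linear_form b)) = [:\<Prod>b\<in>Par. dot b p:]"
proof -
  have "(\<Prod>b\<in>Par. \<rho> (linear_form b)) = (\<Prod>b\<in>Par. [:dot b p:])"
    by (intro prod.cong) (auto simp: Par_def \<rho>_linear_form)
  also have "\<dots> = [:\<Prod>b\<in>Par. dot b p:]" using Par_finite by induction auto
  finally show ?thesis .
qed

lemma \<rho>_F_at: "(\<Prod>b\<in>F_at \<tau>. \<rho> (linear_form b)) = smult (\<Prod>b\<in>F_at \<tau>. dot b q) ([:-\<tau>, 1:] ^ card (F_at \<tau>))"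
proof -
  have "(\<Prod>b\<in>F_at \<tau>. \<rho> (linear_form b)) = (\<Prod>b\<in>F_at \<tau>. smult (dot b q) [:-\<tau>, 1:])"
    by (intro prod.cong refl) (simp only: F_at_iff)
  thus ?thesis by (simp only: prod_smult prod_constant)
qed

lemma F_at_prod_nonzero: "(\<Prod>b\<in>F_at \<tau>. dot b q) \<noteq> 0"
  using F_at_finite by (auto simp: F_at_iff)

lemma scaling_nonzero: "scaling \<noteq> 0"
proof -
  have "dot b p \<noteq> 0" if "b \<in> Par" for b
    using \<rho>_nonzero[of b] that by (auto simp: Par_def \<rho>_linear_form)
  thus ?thesis using Par_finite T_finite F_at_prod_nonzero by (auto simp: scaling_def)
qed

lemma \<rho>_prod_F: "(\<Prod>b\<in>F. \<rho> (linear_form b)) = B * R"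
proof -
  have "(\<Prod>b\<in>F. \<rho> (linear_form b)) =
      (\<Prod>b\<in>Par. \<rho> (linear_form b)) * (\<Prod>b\<in>(\<Union>\<tau>\<in>T. F_at \<tau>). \<rho> (linear_form b))"
    using Par_finite T_finite F_at_finite F_decompose(2)
    by (subst F_decompose(1), intro prod.union_disjoint) auto
  also have "(\<Prod>b\<in>(\<Union>\<tau>\<in>T. F_at \<tau>). \<rho> (linear_form b)) = (\<Prod>\<tau>\<in>T. \<Prod>b\<in>F_at \<tau>. \<rho> (linear_form b))"
    using T_finite F_at_finite F_at_disjoint by (intro prod.UNION_disjoint) auto
  also have "\<dots> = smult (\<Prod>\<tau>\<in>T. \<Prod>b\<in>F_at \<tau>. dot b q) (\<Prod>\<tau>\<in>T. [:-\<tau>, 1:] ^ card (F_at \<tau>))"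
    by (simp only: \<rho>_F_at prod_smult)
  also have "(\<Prod>\<tau>\<in>T. [:-\<tau>, 1:] ^ card (F_at \<tau>)) =
      (\<Prod>\<tau>\<in>T. [:-\<tau>, 1:] ^ (card (F_at \<tau>) - 1) * [:-\<tau>, 1:])"
  proof (intro prod.cong refl)
    fix \<tau> assume "\<tau> \<in> T"
    hence "card (F_at \<tau>) = Suc (card (F_at \<tau>) - 1)" using card_F_at_pos[of \<tau>] by simp
    thus "[:-\<tau>, 1:] ^ card (F_at \<tau>) = [:-\<tau>, 1:] ^ (card (F_at \<tau>) - 1) * [:-\<tau>, 1:]"
      by (metis power_Suc2)
  qed
  also have "\<dots> = (\<Prod>\<tau>\<in>T. [:-\<tau>, 1:] ^ (card (F_at \<tau>) - 1)) * R"
    by (simp only: prod.distrib R_def)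
  finally show ?thesis by (simp add: \<rho>_Par B_def scaling_def)
qed

lemma B_nonzero: "B \<noteq> 0"
  using scaling_nonzero T_finite by (auto simp: B_def)

lemma degree_B: "int (degree B) = int (card F) - int (card Par) - int (card T)"
proof -
  have "degree B = (\<Sum>\<tau>\<in>T. card (F_at \<tau>) - 1)"
    using scaling_nonzero by (simp add: B_def) (subst degree_prod_eq_sum_degree, auto simp: degree_linear_power)
  also have "int \<dots> = (\<Sum>\<tau>\<in>T. int (card (F_at \<tau>)) - 1)"
    using card_F_at_pos by (auto simp: of_nat_diff)
  also have "\<dots> = int (\<Sum>\<tau>\<in>T. card (F_at \<tau>)) - int (card T)" by (simp add: sum_subtractf)
  also have "(\<Sum>\<tau>\<in>T. card (F_at \<tau>)) = card (\<Union>\<tau>\<in>T. F_at \<tau>)"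
    using T_finite F_at_finite F_at_disjoint by (intro card_UN_disjoint[symmetric]) auto
  also have "int \<dots> = int (card F) - int (card Par)"
  proof -
    have "card F = card Par + card (\<Union>\<tau>\<in>T. F_at \<tau>)"
      using Par_finite T_finite F_at_finite F_decompose(2)
      by (subst F_decompose(1), intro card_Un_disjoint) auto
    thus ?thesis by simp
  qed
  finally show ?thesis .
qed

text \<open>Among the planes of \<open>F\<close> through the line of \<open>\<tau>\<close> fix one, \<open>b1\<close>. Each plane \<open>b\<close> among them is a
  combination of \<open>a\<close> and \<open>b1\<close>; as the field and the Euler field map the form of \<open>b\<close> to multiples of
  itself, this form divides the determinant \<open>G\<close> of their values at \<open>a\<close> and \<open>b1\<close>. On the plane of \<open>a\<close> this determinant is the restricted value of the
  field times the form of \<open>b1\<close>, which accounts for one of the factors \<open>t - \<tau>\<close>.\<close>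

lemma power_dvd_\<rho>_value:
  assumes g: "g \<in> D0 a0 F d" and \<tau>: "\<tau> \<in> T"
  shows "[:-\<tau>, 1:] ^ (card (F_at \<tau>) - 1) dvd \<rho> (dot (cvec a) g)"
proof -
  obtain b1 where b1: "b1 \<in> F_at \<tau>" using \<tau> by (auto simp: T_def)
  define G where "G = dot (cvec a) g * linear_form b1 - linear_form a * dot (cvec b1) g"
  have "(\<Prod>b\<in>F_at \<tau>. linear_form b) dvd G"
  proof (rule prod_linear_forms_dvd[OF F_at_finite])
    fix b assume b: "b \<in> F_at \<tau>"
    define P where "P = p + \<tau> *s q"
    have P: "dot a P = 0" "dot b P = 0" "dot b1 P = 0" "dot a0 P = 1"
      using b b1 by (auto simp: P_def dot_linear dual_basis F_at_def \<rho>_linear_form)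
    have "dot a (cross b1 b) *s P = 0"
      using cramer3_dual[of a b1 b P] P by (simp add: dot_commute[of P])
    hence "dot a0 (dot a (cross b1 b) *s P) = 0" by (simp only: dot_linear)
    hence "dot a (cross b1 b) = 0" using P(4) by (simp add: dot_linear)
    hence "dot b (cross a b1) = 0" using dot_cross_rotate[of b a b1] by simp
    moreover have "cross a b1 \<noteq> 0" using b1 a_F by (auto simp: F_at_def)
    ultimately obtain x y where xy: "b = x *s a + y *s b1" using lin_comb_if_det_zero by blast
    have "y \<noteq> 0"
    proof
      assume "y = 0"
      hence "cross a b = 0" by (simp add: xy cross_linear)
      thus False using b a_F by (auto simp: F_at_def)
    qed
    have "Const y * G = dot (cvec a) g * linear_form b - linear_form a * dot (cvec b) g"
      unfolding G_def xy by (simp add: linear_form_linear cvec_linear dot_linear algebra_simps)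
    moreover have "linear_form b dvd dot (cvec b) g" using g b by (auto simp: D0_def F_at_def)
    ultimately have "linear_form b dvd Const y * G" by simp
    thus "linear_form b dvd G" using \<open>y \<noteq> 0\<close> by (simp add: dvd_Const_mult_iff)
  qed (use F_nonzero pairwise_F in \<open>auto simp: F_at_def\<close>)
  hence "\<rho> (\<Prod>b\<in>F_at \<tau>. linear_form b) dvd \<rho> G"
    unfolding \<rho>_def by (rule univ.ev_dvd)
  hence "smult (\<Prod>b\<in>F_at \<tau>. dot b q) ([:-\<tau>, 1:] ^ card (F_at \<tau>)) dvd
      \<rho> (dot (cvec a) g) * \<rho> (linear_form b1)"
    by (simp add: G_def \<rho>_F_at)
  hence "[:-\<tau>, 1:] ^ card (F_at \<tau>) dvd \<rho> (dot (cvec a) g) * \<rho> (linear_form b1)"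
    using F_at_prod_nonzero smult_dvd_cancel by blast
  also have "\<rho> (linear_form b1) = smult (dot b1 q) [:-\<tau>, 1:]" using b1 by (simp only: F_at_iff)
  finally have "[:-\<tau>, 1:] ^ card (F_at \<tau>) dvd smult (dot b1 q) (\<rho> (dot (cvec a) g) * [:-\<tau>, 1:])"
    by (simp only: mult_smult_right)
  hence "[:-\<tau>, 1:] ^ card (F_at \<tau>) dvd \<rho> (dot (cvec a) g) * [:-\<tau>, 1:]"
    using b1 by (subst (asm) dvd_smult_iff) (auto simp: F_at_iff)
  moreover have "[:-\<tau>, 1:] ^ card (F_at \<tau>) = [:-\<tau>, 1:] ^ (card (F_at \<tau>) - 1) * [:-\<tau>, 1:]"
    using card_F_at_pos[OF \<tau>] by (metis One_nat_def Suc_diff_le diff_Suc_1 diff_Suc_Suc minus_nat.diff_0 power_Suc2)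
  ultimately show ?thesis by (metis dvd_mult_cancel_right pCons_eq_0_iff one_neq_zero)
qed

text \<open>The coefficient vector of a plane in \<open>Par\<close> is a combination of \<open>a0\<close> and \<open>a\<close>, and the field
  annihilates the form of \<open>a0\<close>; hence the forms of these planes divide the value at \<open>a\<close>. Their
  restrictions are constants, so dividing by them lowers the degree bound.\<close>

lemma \<rho>_value_degree:
  assumes g: "g \<in> D0 a0 F d"
  shows "\<rho> (dot (cvec a) g) \<in> deg_lt (d - int (card Par) + 1)"
proof -
  have "(\<Prod>b\<in>Par. linear_form b) dvd dot (cvec a) g"
  proof (rule prod_linear_forms_dvd[OF Par_finite])
    fix b assume b: "b \<in> Par"
    hence "dot b (cross a0 a) = 0" using cross_commute[of a0 a] by (simp add: Par_def q_def dot_def algebra_simps)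
    moreover have "cross a0 a \<noteq> 0"
      using dual_basis(5) cross_commute[of a0 a] by (auto simp: q_def dot_linear)
    ultimately obtain x y where xy: "b = x *s a0 + y *s a" using lin_comb_if_det_zero by blast
    have "y \<noteq> 0"
    proof
      assume "y = 0"
      hence "cross a0 b = 0" by (simp add: xy cross_linear)
      thus False using b a0_F by (auto simp: Par_def)
    qed
    have "dot (cvec b) g = Const y * dot (cvec a) g"
      using g by (simp add: xy cvec_linear dot_linear D0_def)
    moreover have "linear_form b dvd dot (cvec b) g" using g b by (auto simp: D0_def Par_def)
    ultimately show "linear_form b dvd dot (cvec a) g" using \<open>y \<noteq> 0\<close> by (simp add: dvd_Const_mult_iff)
  qed (use F_nonzero pairwise_F in \<open>auto simp: Par_def\<close>)
  then obtain f where f: "dot (cvec a) g = (\<Prod>b\<in>Par. linear_form b) * f" by (auto elim: dvdE)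
  have "(\<Prod>b\<in>Par. linear_form b) \<noteq> 0" using Par_finite F_nonzero by (auto simp: Par_def)
  moreover have "dot (cvec a) g \<in> forms d" using g by (intro dot_cvec_in_forms) (auto simp: D0_def)
  ultimately have "f \<in> forms (d - int (card Par))"
    using f forms_cancel[OF forms_prod[OF Par_finite, of linear_form]] linear_form_in_forms by metis
  hence "\<rho> f \<in> deg_lt (d - int (card Par) + 1)" by (rule \<rho>_in_deg_lt)
  hence "smult (\<Prod>b\<in>Par. dot b p) (\<rho> f) \<in> deg_lt (d - int (card Par) + 1)"
    by (rule pvec.subspace_scale[OF deg_lt_subspace])
  thus ?thesis by (simp add: f \<rho>_Par)
qed

lemma linear_\<rho>_value: "Vector_Spaces.linear vscale smult (\<lambda>g. \<rho> (dot (cvec a) g))"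
  by (simp add: Vector_Spaces.linear_iff vscale_def vvec.vector_space_axioms pvec.vector_space_axioms dot_linear)

text \<open>The fields that fill the image are multiples of products of the forms of all planes of \<open>F\<close> but one
  with constant vectors. Such a product has degree \<open>card F - 1\<close>, whence the bound on \<open>d\<close>.\<close>

lemma image_\<rho>_value:
  assumes d: "d + 1 \<ge> int (card F)"
  shows "(\<lambda>g. \<rho> (dot (cvec a) g)) ` D0 a0 F d = (*) B ` deg_lt (d + 1 - int (card F) + int (card T))"
    (is "?I = (*) B ` deg_lt ?m")
proof (intro subset_antisym subsetI)
  fix r assume "r \<in> ?I"
  then obtain g where g: "g \<in> D0 a0 F d" "r = \<rho> (dot (cvec a) g)" by blast
  have "(\<Prod>\<tau>\<in>T. [:-\<tau>, 1:] ^ (card (F_at \<tau>) - 1)) dvd r"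
    unfolding g(2) by (intro prod_linear_powers_dvd T_finite power_dvd_\<rho>_value[OF g(1)])
  hence "B dvd r" using scaling_nonzero by (simp add: B_def smult_dvd_iff)
  then obtain x where x: "r = B * x" by (auto elim: dvdE)
  have "x \<in> deg_lt ?m"
  proof (cases "x = 0")
    case False
    hence "degree r = degree B + degree x" using B_nonzero by (simp add: x degree_mult_eq)
    moreover have "int (degree r) < d - int (card Par) + 1"
      using \<rho>_value_degree[OF g(1)] False B_nonzero unfolding g(2)[symmetric] deg_lt_iff x by simp
    ultimately show ?thesis using degree_B by (simp add: deg_lt_iff)
  qed (simp add: deg_lt_iff)
  thus "r \<in> (*) B ` deg_lt ?m" using x by blast
next
  interpret L: Vector_Spaces.linear vscale smult "\<lambda>g. \<rho> (dot (cvec a) g)" by (rule linear_\<rho>_value)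
  have I: "pvec.subspace ?I" by (rule L.subspace_image[OF D0_subspace])
  have field_in_D0: "(h * (\<Prod>b\<in>C. linear_form b)) *s cvec v \<in> D0 a0 F d"
    if "C \<subseteq> F" "h \<in> forms (d - int (card C))" "dot a0 v = 0" "\<And>b. b \<in> F - C \<Longrightarrow> dot b v = 0" for C h v
  proof -
    have fC: "finite C" using that(1) finite_F finite_subset by blast
    have "h * (\<Prod>b\<in>C. linear_form b) * Const c \<in> forms (d - int (card C) + int (card C) + 0)" for c
      by (intro forms_mult that(2) forms_prod fC linear_form_in_forms Const_in_forms)
    hence "h * (\<Prod>b\<in>C. linear_form b) * Const c \<in> forms d" for c by simp
    moreover have "linear_form b dvd h * (\<Prod>b\<in>C. linear_form b) * Const (dot b v)" if b: "b \<in> F" for b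
    proof (cases "b \<in> C")
      case True
      hence "linear_form b dvd (\<Prod>b\<in>C. linear_form b)" using fC by (rule dvd_prodI[rotated])
      thus ?thesis by simp
    next
      case False
      thus ?thesis using b \<open>\<And>b. b \<in> F - C \<Longrightarrow> dot b v = 0\<close> by simp
    qed
    ultimately show ?thesis using that(3) by (simp add: D0_def dot_linear dot_cvec)
  qed
  \<comment> \<open>The transversal field \<open>w\<close> lies in \<open>H0\<close>; its multiple by all forms of \<open>F\<close> is logarithmic.\<close>
  have full: "B * (R * s) \<in> ?I" if s: "s \<in> deg_lt (d + 1 - int (card F))" for s
  proof (cases "s = 0")
    case True
    thus ?thesis using pvec.subspace_0[OF I] by simp
  next
    case False
    define k where "k = nat (d - int (card F))"
    have k: "d - int (card F) = int k" using s False by (simp add: deg_lt_iff k_def)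
    have h: "homog k s \<in> forms (d - int (card F))" "\<rho> (homog k s) = s"
      using s k homog_in_forms[of k s] \<rho>_homog[of s k] by (simp_all add: algebra_simps)
    have "(homog k s * (\<Prod>b\<in>F. linear_form b)) *s cvec w \<in> D0 a0 F d"
      using h by (intro field_in_D0) (auto simp: dual_basis)
    moreover have "\<rho> (dot (cvec a) ((homog k s * (\<Prod>b\<in>F. linear_form b)) *s cvec w)) = B * (R * s)"
      by (simp add: dot_linear dot_cvec dual_basis h \<rho>_prod_F)
    ultimately show ?thesis by (metis image_eqI)
  qed
  \<comment> \<open>The vector \<open>v\<close> spans the intersection of \<open>H0\<close> with the plane of \<open>b\<close>, so the form of \<open>b\<close> can be left out.\<close>
  have partial: "B * (\<Prod>\<sigma>\<in>T - {\<tau>}. [:-\<sigma>, 1:]) \<in> ?I" if \<tau>: "\<tau> \<in> T" for \<tau>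
  proof -
    obtain b where b: "b \<in> F_at \<tau>" using \<tau> by (auto simp: T_def)
    hence bF: "b \<in> F" by (simp add: F_at_def)
    define v where "v = cross a0 b"
    have v: "dot a0 v = 0" "dot b v = 0" "dot a v = dot b q"
      using dot_cross_rotate[of a a0 b] dot_cross_rotate[of b a a0] by (simp_all add: v_def q_def)
    define C where "C = F - {b}"
    have C: "card F = card C + 1" using card.remove[OF finite_F bF] by (simp add: C_def)
    define k where "k = nat (d - int (card C))"
    have k: "d - int (card C) = int k" using d C by (simp add: k_def)
    have h: "homog k 1 \<in> forms (d - int (card C))" "\<rho> (homog k 1) = 1"
      using k homog_in_forms[of k 1] \<rho>_homog[of 1 k] by (simp_all add: deg_lt_iff)
    define X where "X = (\<Prod>b\<in>C. \<rho> (linear_form b))"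
    have "(homog k 1 * (\<Prod>b\<in>C. linear_form b)) *s cvec v \<in> D0 a0 F d"
      using h v by (intro field_in_D0) (auto simp: C_def)
    moreover have "\<rho> (dot (cvec a) ((homog k 1 * (\<Prod>b\<in>C. linear_form b)) *s cvec v)) = smult (dot b q) X"
      by (simp add: dot_linear dot_cvec v h X_def)
    moreover have "smult (dot b q) X = B * (\<Prod>\<sigma>\<in>T - {\<tau>}. [:-\<sigma>, 1:])"
    proof -
      have "\<rho> (linear_form b) * X = (\<Prod>b\<in>F. \<rho> (linear_form b))"
        unfolding X_def C_def using finite_F bF by (rule prod.remove[symmetric])
      also have "\<dots> = B * ([:-\<tau>, 1:] * (\<Prod>\<sigma>\<in>T - {\<tau>}. [:-\<sigma>, 1:]))"
        unfolding \<rho>_prod_F R_def using prod.remove[OF T_finite \<tau>] by metis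
      also have "\<rho> (linear_form b) = smult (dot b q) [:-\<tau>, 1:]" using b by (simp only: F_at_iff)
      finally have "[:-\<tau>, 1:] * smult (dot b q) X = [:-\<tau>, 1:] * (B * (\<Prod>\<sigma>\<in>T - {\<tau>}. [:-\<sigma>, 1:]))"
        by (simp only: mult_smult_left mult_smult_right mult.left_commute)
      thus ?thesis by (rule mult_left_cancel[THEN iffD1, rotated]) simp
    qed
    ultimately show ?thesis by (metis image_eqI)
  qed
  fix r assume "r \<in> (*) B ` deg_lt ?m"
  then obtain x where x: "r = B * x" "x \<in> deg_lt ?m" by blast
  obtain c s where cs: "x = R * s + (\<Sum>\<tau>\<in>T. smult (c \<tau>) (\<Prod>\<sigma>\<in>T - {\<tau>}. [:-\<sigma>, 1:]))"
      "s \<in> deg_lt (?m - int (card T))"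
    using lagrange_decomposition[OF T_finite x(2)] d unfolding R_def by auto
  have "r = B * (R * s) + (\<Sum>\<tau>\<in>T. smult (c \<tau>) (B * (\<Prod>\<sigma>\<in>T - {\<tau>}. [:-\<sigma>, 1:])))"
    unfolding x(1) cs(1) by (simp only: distrib_left sum_distrib_left mult_smult_right)
  also have "\<dots> \<in> ?I"
    using cs(2) by (intro pvec.subspace_add[OF I] pvec.subspace_sum[OF I] pvec.subspace_scale[OF I] full partial) simp_all
  finally show "r \<in> ?I" .
qed

lemma dim_D0_insert:
  assumes d: "d + 1 \<ge> int (card F)"
  shows "int (vvec.dim (D0 a0 F d)) =
    int (vvec.dim (D0 a0 (insert a F) d)) + (d + 1 - int (card F) + int (card T))"
proof -
  let ?f = "\<lambda>g. \<rho> (dot (cvec a) g)" and ?V = "D0 a0 F d"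
  let ?m = "d + 1 - int (card F) + int (card T)"
  have K: "{g \<in> ?V. ?f g = 0} = D0 a0 (insert a F) d"
    using linear_form_dvd_iff_\<rho>[OF dot_cvec_in_forms] by (auto simp: D0_def)
  have mult: "Vector_Spaces.linear smult smult ((*) B)"
    by (simp add: Vector_Spaces.linear_iff pvec.vector_space_axioms distrib_left)
  have fV: "fin_dim vscale ?V"
    by (rule fin_dim_subset[OF dim_D0_empty(1)]) (auto simp: D0_def)
  have fK: "fin_dim vscale {g \<in> ?V. ?f g = 0}" by (rule fin_dim_subset[OF fV]) auto
  have fI: "fin_dim smult (?f ` ?V)" by (rule fin_dim_image[OF linear_\<rho>_value fV])
  have "pvec.dim (?f ` ?V) = pvec.dim (deg_lt ?m :: 'k poly set)"
    unfolding image_\<rho>_value[OF d]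
    by (rule dim_image_inj_on[OF mult deg_lt_subspace]) (use B_nonzero in simp)
  also have "int \<dots> = ?m" using d by (simp add: dim_deg_lt)
  finally have "int (pvec.dim (?f ` ?V)) = ?m" .
  thus ?thesis
    using dim_eq_dim_kernel_plus_dim_image[OF linear_\<rho>_value D0_subspace fK fI] unfolding K by simp
qed

end

lemma exists_frame:
  fixes a0 a :: "'k::field ^ 3"
  assumes "cross a0 a \<noteq> 0"
  shows "\<exists>\<nu>. frame a0 \<nu> a"
proof -
  have "cross a a0 \<noteq> 0" using assms cross_commute[of a0 a] by auto
  then obtain i where i: "cross a a0 $ i \<noteq> 0" by (auto simp: vec_eq_iff)
  have "dot (axis i (1 / cross a a0 $ i)) (cross a a0) = 1"
    using i exhaust_3[of i] by (elim disjE) (auto simp: dot_def axis_def simp del: cross_nth)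
  thus ?thesis using dot_cross_rotate[of a0 _ a] by (metis frame.intro)
qed

lemma exists_not_proportional:
  fixes a0 :: "'k::field ^ 3"
  assumes "a0 \<noteq> 0"
  shows "\<exists>a. cross a0 a \<noteq> 0"
proof (rule ccontr)
  assume "\<not> (\<exists>a. cross a0 a \<noteq> 0)"
  hence "cross a0 (axis 1 1) = 0" "cross a0 (axis 2 1) = 0" by auto
  hence "a0 = 0" by (auto simp: vec3_eq_iff axis_def)
  thus False using assms by simp
qed

lemma fin_dim_D0: "a0 \<noteq> 0 \<Longrightarrow> fin_dim vscale (D0 a0 F d)"
  by (rule fin_dim_subset[of _ "D0 a0 {} d"])
    (use exists_not_proportional exists_frame frame.dim_D0_empty(1) in blast, auto simp: D0_def)

text \<open>In degree \<open>d\<close> each added plane lowers the dimension by \<open>d + 1\<close> up to a constant. The formula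
  includes \<open>d = - 1\<close> if \<open>F\<close> has at most one element, and \<open>d = - 2\<close> if \<open>F\<close> is empty; then it
  determines the constant.\<close>

lemma dim_D0:
  fixes a0 :: "'k::field ^ 3"
  assumes a0: "a0 \<noteq> 0" and "finite F" and "\<And>b. b \<in> F \<Longrightarrow> cross a0 b \<noteq> 0"
    and "\<And>b c. b \<in> F \<Longrightarrow> c \<in> F \<Longrightarrow> b \<noteq> c \<Longrightarrow> cross b c \<noteq> 0"
  shows "\<exists>c. \<forall>d. d + 2 \<ge> int (card F) \<longrightarrow>
    int (vvec.dim (D0 a0 F d)) = (d + 1) * (d + 2) - int (card F) * (d + 1) + c"
  using assms(2-)
proof (induction F rule: finite_induct)
  case empty
  obtain \<nu> a where "frame a0 \<nu> a" using exists_not_proportional[OF a0] exists_frame by blast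
  hence "int (vvec.dim (D0 a0 {} d)) = (d + 1) * (d + 2)" if "d \<ge> -2" for d
    using that frame.dim_D0_empty(2)[of a0 \<nu> a d] dim_forms[of d, where 'k='k] by simp
  thus ?case by (intro exI[of _ 0]) simp
next
  case (insert a F)
  obtain \<nu> where "frame a0 \<nu> a" using insert.prems(1) exists_frame by blast
  then interpret frame a0 \<nu> a .
  interpret added_plane a0 \<nu> a F
    using insert.hyps insert.prems by unfold_locales auto
  obtain c where c: "\<And>d. d + 2 \<ge> int (card F) \<Longrightarrow>
      int (vvec.dim (D0 a0 F d)) = (d + 1) * (d + 2) - int (card F) * (d + 1) + c"
    using insert by blast
  show ?case
  proof (intro exI[of _ "c + int (card F) - int (card T)"] allI impI)
    fix d assume d: "d + 2 \<ge> int (card (insert a F))"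
    hence "d + 1 \<ge> int (card F)" using insert.hyps by simp
    thus "int (vvec.dim (D0 a0 (insert a F) d)) = (d + 1) * (d + 2) -
        int (card (insert a F)) * (d + 1) + (c + int (card F) - int (card T))"
      using dim_D0_insert[of d] c[of d] insert.hyps by (simp add: algebra_simps)
  qed
qed

section \<open>Coefficient modules of logarithmic multiderivations\<close>

text \<open>In this and the next two definitions: the coefficients of the logarithmic multiderivations with
  one, two and three arguments, for the planes with coefficient vectors in \<open>C\<close>.\<close>

definition D1 :: "('k::field ^ 3) set \<Rightarrow> int \<Rightarrow> ((3, 'k) coord_ring ^ 3) set" where
  "D1 C d = {g. (\<forall>i. g $ i \<in> forms d) \<and> (\<forall>b\<in>C. linear_form b dvd dot (cvec b) g)}"

definition D2 :: "('k::field ^ 3) set \<Rightarrow> int \<Rightarrow> ((3, 'k) coord_ring ^ 3) set" where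
  "D2 C d = {g. (\<forall>i. g $ i \<in> forms d) \<and> (\<forall>b\<in>C. \<forall>i. linear_form b dvd cross g (cvec b) $ i)}"

definition D3 :: "('k::field ^ 3) set \<Rightarrow> int \<Rightarrow> (3, 'k) coord_ring set" where
  "D3 C d = {f \<in> forms d. \<forall>b\<in>C. linear_form b dvd f}"

lemma D1_subspace: "vvec.subspace (D1 C d)"
  by (auto simp: vvec.subspace_def vscale_def D1_def dot_linear intro: forms_add forms_Const_mult)

lemma D2_subspace: "vvec.subspace (D2 C d)"
  unfolding vvec.subspace_def vscale_def D2_def
  by (auto simp: cross_linear simp del: cross_nth intro: forms_add forms_Const_mult)

lemma D3_subspace: "fvec.subspace (D3 C d)"
  by (auto simp: fvec.subspace_def fscale_def D3_def intro: forms_add forms_Const_mult)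

lemma linear_mult: "Vector_Spaces.linear fscale fscale ((*) x)"
  by (simp add: Vector_Spaces.linear_iff fscale_def fvec.vector_space_axioms distrib_left mult.left_commute)

lemma linear_vector_mult: "Vector_Spaces.linear vscale vscale ((*s) x)"
  by (simp add: Vector_Spaces.linear_iff vscale_def vvec.vector_space_axioms vec_eq_iff distrib_left mult.left_commute)

lemma linear_cross: "Vector_Spaces.linear vscale vscale (\<lambda>g. cross g x)"
  by (simp add: Vector_Spaces.linear_iff vscale_def vvec.vector_space_axioms cross_linear)

locale plane_vectors =
  fixes a0 :: "'k::field ^ 3" and F :: "('k ^ 3) set"
  assumes a0_nonzero: "a0 \<noteq> 0"
    and finite_F: "finite F"
    and a0_F: "\<And>b. b \<in> F \<Longrightarrow> cross a0 b \<noteq> 0"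
    and pairwise_F: "\<And>b c. b \<in> F \<Longrightarrow> c \<in> F \<Longrightarrow> b \<noteq> c \<Longrightarrow> cross b c \<noteq> 0"
begin

lemma F_nonzero: "b \<in> F \<Longrightarrow> b \<noteq> 0"
  using a0_F[of b] by (auto simp: cross_linear)

lemma a0_not_in_F: "a0 \<notin> F"
  using a0_F[of a0] by auto

lemma pairwise_insert:
  assumes "b \<in> insert a0 F" "c \<in> insert a0 F" "b \<noteq> c"
  shows "cross b c \<noteq> 0"
  using assms a0_F pairwise_F cross_commute[of b a0] by auto

lemma prod_F_nonzero: "(\<Prod>b\<in>F. linear_form b) \<noteq> 0"
  using finite_F F_nonzero by auto

text \<open>The value of a field at the form of \<open>a0\<close> is a multiple of this form, and all multiples are attained
  by multiples of the Euler field \<open>vars\<close>.\<close>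

lemma dim_D1: "vvec.dim (D1 (insert a0 F) d) =
  fvec.dim (forms (d - 1) :: (3, 'k) coord_ring set) + vvec.dim (D0 a0 F d)"
proof -
  let ?V = "D1 (insert a0 F) d" and ?f = "dot (cvec a0)"
  have K: "{g \<in> ?V. ?f g = 0} = D0 a0 F d" by (auto simp: D0_def D1_def)
  have I: "?f ` ?V = (*) (linear_form a0) ` forms (d - 1)"
  proof (intro subset_antisym subsetI)
    fix f assume "f \<in> ?f ` ?V"
    then obtain g where g: "g \<in> ?V" "f = ?f g" by blast
    then have "linear_form a0 dvd f" by (simp add: D1_def)
    then obtain h where h: "f = linear_form a0 * h" by (blast elim: dvdE)
    have "f \<in> forms d" using g unfolding g(2) by (intro dot_cvec_in_forms) (auto simp: D1_def)
    hence "h \<in> forms (d - 1)" using linear_form_cancel[OF a0_nonzero] h by blast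
    thus "f \<in> (*) (linear_form a0) ` forms (d - 1)" using h by blast
  next
    fix f assume "f \<in> (*) (linear_form a0) ` forms (d - 1)"
    then obtain h where h: "f = linear_form a0 * h" "h \<in> forms (d - 1)" by blast
    have dot: "dot (cvec b) (h *s vars) = linear_form b * h" for b
      by (simp add: dot_linear linear_form_eq_dot mult.commute)
    have "h * Var i \<in> forms d" for i
      using forms_mult[OF h(2) Var_in_forms[of i]] by simp
    hence "h *s vars \<in> ?V" by (simp add: D1_def dot)
    thus "f \<in> ?f ` ?V" using dot h(1) by (metis image_eqI)
  qed
  have fK: "fin_dim vscale {g \<in> ?V. ?f g = 0}" unfolding K by (rule fin_dim_D0[OF a0_nonzero])
  have fI: "fin_dim fscale (?f ` ?V)" unfolding I by (rule fin_dim_image[OF linear_mult fin_dim_forms])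
  have "fvec.dim ((*) (linear_form a0) ` forms (d - 1)) = fvec.dim (forms (d - 1) :: (3, 'k) coord_ring set)"
    by (rule dim_image_inj_on[OF linear_mult forms_subspace]) (use a0_nonzero in simp)
  thus ?thesis
    using dim_eq_dim_kernel_plus_dim_image[OF linear_dot D1_subspace fK fI] unfolding K I by simp
qed

lemma dim_D3: "fvec.dim (D3 (insert a0 F) d) =
  fvec.dim (forms (d - int (card F) - 1) :: (3, 'k) coord_ring set)"
proof -
  let ?Q = "\<Prod>b\<in>insert a0 F. linear_form b"
  have Q0: "?Q \<noteq> 0" using finite_F F_nonzero a0_nonzero by auto
  have Qf: "?Q \<in> forms (int (card F + 1))"
    using forms_prod[of "insert a0 F" linear_form] linear_form_in_forms finite_F a0_not_in_F by auto
  have "D3 (insert a0 F) d = (*) ?Q ` forms (d - int (card F) - 1)"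
  proof (intro subset_antisym subsetI)
    fix f assume f: "f \<in> D3 (insert a0 F) d"
    have "?Q dvd f"
      using f finite_F F_nonzero a0_nonzero pairwise_insert
      by (intro prod_linear_forms_dvd) (auto simp: D3_def)
    then obtain h where h: "f = ?Q * h" by (auto elim: dvdE)
    hence "h \<in> forms (d - int (card F + 1))" using forms_cancel[OF Qf Q0, of h d] f by (simp add: D3_def)
    thus "f \<in> (*) ?Q ` forms (d - int (card F) - 1)" using h by (auto simp: algebra_simps)
  next
    fix f assume "f \<in> (*) ?Q ` forms (d - int (card F) - 1)"
    then obtain h where h: "f = ?Q * h" "h \<in> forms (d - int (card F) - 1)" by blast
    have "f \<in> forms d" using forms_mult[OF Qf h(2)] h(1) by simp
    moreover have "linear_form b dvd f" if "b \<in> insert a0 F" for b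
      unfolding h(1) using finite_F that by (intro dvd_mult2 dvd_prodI) auto
    ultimately show "f \<in> D3 (insert a0 F) d" by (simp add: D3_def)
  qed
  moreover have "fvec.dim ((*) ?Q ` forms (d - int (card F) - 1)) =
      fvec.dim (forms (d - int (card F) - 1) :: (3, 'k) coord_ring set)"
    by (rule dim_image_inj_on[OF linear_mult forms_subspace]) (use Q0 in simp)
  ultimately show ?thesis by simp
qed

text \<open>Vectors of polynomials parallel to \<open>a0\<close>: their multiplier has to be divisible by the forms of \<open>F\<close>,
  because the vector product of \<open>a0\<close> with another coefficient vector is a nonzero constant vector.\<close>

lemma kernel_D2:
  "{g \<in> D2 (insert a0 F) d. cross g (cvec a0) = 0} =
   (\<lambda>f. f *s cvec a0) ` ((*) (\<Prod>b\<in>F. linear_form b) ` forms (d - int (card F)))"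
proof (intro subset_antisym subsetI)
  fix g assume g: "g \<in> {g \<in> D2 (insert a0 F) d. cross g (cvec a0) = 0}"
  obtain i where i: "a0 $ i \<noteq> 0" using a0_nonzero by (auto simp: vec_eq_iff)
  define \<mu> where "\<mu> = (axis i (1 / a0 $ i) :: 'k ^ 3)"
  have \<mu>: "dot a0 \<mu> = 1" using i exhaust_3[of i] by (auto simp: \<mu>_def dot_def axis_def)
  define f where "f = dot g (cvec \<mu>)"
  have "cross (cross g (cvec a0)) (cvec \<mu>) = f *s cvec a0 - dot (cvec a0) (cvec \<mu>) *s g"
    unfolding f_def by (rule cross_cross)
  hence gf: "g = f *s cvec a0" using g \<mu> by (simp add: dot_cvec cross_linear)
  have f: "f \<in> forms d"
    unfolding f_def dot_commute[of g] using g by (intro dot_cvec_in_forms) (auto simp: D2_def)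
  have "(\<Prod>b\<in>F. linear_form b) dvd f"
  proof (rule prod_linear_forms_dvd[OF finite_F])
    fix b assume b: "b \<in> F"
    obtain j where j: "cross a0 b $ j \<noteq> 0" using a0_F[OF b] by (auto simp: vec_eq_iff)
    have "linear_form b dvd cross g (cvec b) $ j" using g b unfolding D2_def by blast
    also have "cross g (cvec b) $ j = Const (cross a0 b $ j) * f"
      unfolding gf cross_linear cross_cvec vector_smult_component cvec_nth by (rule mult.commute)
    finally show "linear_form b dvd f" using dvd_Const_mult_iff[OF j] by blast
  qed (use F_nonzero pairwise_F in auto)
  then obtain h where h: "f = (\<Prod>b\<in>F. linear_form b) * h" by (auto elim: dvdE)
  hence "h \<in> forms (d - int (card F))"
    using forms_cancel[OF forms_prod[OF finite_F] prod_F_nonzero, of h d] f linear_form_in_forms by blast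
  thus "g \<in> (\<lambda>f. f *s cvec a0) ` ((*) (\<Prod>b\<in>F. linear_form b) ` forms (d - int (card F)))"
    using gf h by blast
next
  fix g assume "g \<in> (\<lambda>f. f *s cvec a0) ` ((*) (\<Prod>b\<in>F. linear_form b) ` forms (d - int (card F)))"
  then obtain f h where g: "g = f *s cvec a0" "f = (\<Prod>b\<in>F. linear_form b) * h" "h \<in> forms (d - int (card F))"
    by blast
  have "(\<Prod>b\<in>F. linear_form b) * h \<in> forms (int (card F) + (d - int (card F)))"
    by (intro forms_mult forms_prod finite_F linear_form_in_forms g(3))
  hence "f * Const c \<in> forms d" for c using forms_mult[of f d "Const c" 0] by (simp add: g(2))
  hence "g $ i \<in> forms d" for i by (simp add: g(1))
  moreover have cg: "cross g (cvec b) = f *s cvec (cross a0 b)" for b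
    by (simp only: g(1) cross_linear cross_cvec)
  moreover have "linear_form b dvd (f *s cvec (cross a0 b)) $ i" if "b \<in> F" for b i
    unfolding g(2) vector_smult_component using that finite_F by (intro dvd_mult2 dvd_prodI)
  moreover have "cvec (cross a0 a0) = 0" by (simp add: vec_eq_iff)
  ultimately show "g \<in> {g \<in> D2 (insert a0 F) d. cross g (cvec a0) = 0}"
    by (auto simp: D2_def simp del: cross_nth)
qed

text \<open>Contraction with the form of \<open>a0\<close>, divided by this form, maps to vector fields annihilating it; the
  vector product with the Euler field \<open>vars\<close> is a section.\<close>

lemma image_D2:
  "(\<lambda>g. cross g (cvec a0)) ` D2 (insert a0 F) d = (*s) (linear_form a0) ` D0 a0 F (d - 1)"
proof (intro subset_antisym subsetI)
  fix x assume "x \<in> (\<lambda>g. cross g (cvec a0)) ` D2 (insert a0 F) d"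
  then obtain g where g: "g \<in> D2 (insert a0 F) d" "x = cross g (cvec a0)" by blast
  have "\<forall>i. linear_form a0 dvd x $ i" using g unfolding D2_def by blast
  hence "\<forall>i. \<exists>h. x $ i = linear_form a0 * h" unfolding dvd_def by blast
  then obtain h' where h': "\<And>i. x $ i = linear_form a0 * h' i" by metis
  define h where "h = (\<chi> i. h' i)"
  have x: "x = linear_form a0 *s h" using h' by (simp add: h_def vec_eq_iff)
  have "x $ i \<in> forms d" for i
  proof -
    have "g $ j * Const c \<in> forms d" for j c
      using forms_mult[of "g $ j" d "Const c" 0] g(1) by (simp add: D2_def)
    thus ?thesis unfolding g(2) using exhaust_3[of i] by (auto intro!: forms_diff)
  qed
  hence forms: "h $ i \<in> forms (d - 1)" for i
    using linear_form_cancel[OF a0_nonzero, of "h $ i" d] by (simp add: x)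
  have "linear_form a0 * dot (cvec a0) h = dot (cvec a0) (cross g (cvec a0))"
    by (simp only: g(2)[symmetric] x dot_linear)
  hence "dot (cvec a0) h = 0" using a0_nonzero by simp
  moreover have "linear_form b dvd dot (cvec b) h" if b: "b \<in> F" for b
  proof -
    have "linear_form a0 * dot (cvec b) h = dot (cvec b) (cross g (cvec a0))"
      by (simp only: g(2)[symmetric] x dot_linear)
    also have "\<dots> = - dot (cvec a0) (cross g (cvec b))"
      by (simp add: dot_def algebra_simps)
    finally have "linear_form a0 * dot (cvec b) h = - dot (cvec a0) (cross g (cvec b))" .
    moreover have "linear_form b dvd cross g (cvec b) $ i" for i using g(1) b unfolding D2_def by blast
    hence "linear_form b dvd dot (cvec a0) (cross g (cvec b))"
      unfolding dot_def by (intro dvd_add dvd_mult)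
    ultimately have "linear_form b dvd linear_form a0 * dot (cvec b) h" by simp
    moreover have "\<not> linear_form b dvd linear_form a0"
      using cross_zero_if_linear_form_dvd a0_F[OF b] by blast
    ultimately show ?thesis
      using prime_elem_dvd_multD[OF prime_elem_linear_form[OF F_nonzero[OF b]]] by blast
  qed
  ultimately show "x \<in> (*s) (linear_form a0) ` D0 a0 F (d - 1)"
    using forms x by (auto simp: D0_def)
next
  fix x assume "x \<in> (*s) (linear_form a0) ` D0 a0 F (d - 1)"
  then obtain h where h: "x = linear_form a0 *s h" "h \<in> D0 a0 F (d - 1)" by blast
  have cr: "cross (cross vars h) (cvec b) = linear_form b *s h - dot (cvec b) h *s vars" for b
    by (simp only: cross_cross linear_form_eq_dot dot_commute)
  have "Var i * h $ j \<in> forms d" for i j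
    using forms_mult[OF Var_in_forms[of i], of "h $ j" "d - 1"] h(2) by (simp add: D0_def)
  hence "cross vars h $ i \<in> forms d" for i using exhaust_3[of i] by (auto intro!: forms_diff)
  moreover have "linear_form b dvd (linear_form b *s h - dot (cvec b) h *s vars) $ i"
    if "b \<in> insert a0 F" for b i
    using h(2) that by (auto simp: D0_def)
  ultimately have "cross vars h \<in> D2 (insert a0 F) d"
    unfolding D2_def mem_Collect_eq cr by (intro conjI allI ballI)
  moreover have "cross (cross vars h) (cvec a0) = x" using h by (simp add: cr D0_def)
  ultimately show "x \<in> (\<lambda>g. cross g (cvec a0)) ` D2 (insert a0 F) d" by blast
qed

lemma dim_D2: "vvec.dim (D2 (insert a0 F) d) =
  vvec.dim (D0 a0 F (d - 1)) + fvec.dim (forms (d - int (card F)) :: (3, 'k) coord_ring set)"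
proof -
  let ?V = "D2 (insert a0 F) d" and ?f = "\<lambda>g. cross g (cvec a0)"
  let ?Q = "\<Prod>b\<in>F. linear_form b"
  have a0v: "cvec a0 \<noteq> 0" using a0_nonzero by (auto simp: vec_eq_iff)
  interpret Q: Vector_Spaces.linear fscale fscale "(*) ?Q" by (rule linear_mult)
  have "fvec.subspace ((*) ?Q ` forms (d - int (card F)))"
    by (rule Q.subspace_image[OF forms_subspace])
  hence "vvec.dim {g \<in> ?V. ?f g = 0} = fvec.dim ((*) ?Q ` forms (d - int (card F)))"
    unfolding kernel_D2 by (intro dim_image_inj_on[OF linear_scaled_vector]) (use a0v in auto)
  also have "\<dots> = fvec.dim (forms (d - int (card F)) :: (3, 'k) coord_ring set)"
    by (rule dim_image_inj_on[OF linear_mult forms_subspace]) (use prod_F_nonzero in simp)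
  finally have dK: "vvec.dim {g \<in> ?V. ?f g = 0} = fvec.dim (forms (d - int (card F)) :: (3, 'k) coord_ring set)" .
  have dI: "vvec.dim (?f ` ?V) = vvec.dim (D0 a0 F (d - 1))"
    unfolding image_D2
    by (rule dim_image_inj_on[OF linear_vector_mult D0_subspace]) (use a0_nonzero in \<open>auto simp: vec_eq_iff\<close>)
  have fK: "fin_dim vscale {g \<in> ?V. ?f g = 0}"
    unfolding kernel_D2 by (intro fin_dim_image[OF linear_scaled_vector] fin_dim_image[OF linear_mult] fin_dim_forms)
  have fI: "fin_dim vscale (?f ` ?V)"
    unfolding image_D2 by (intro fin_dim_image[OF linear_vector_mult] fin_dim_D0 a0_nonzero)
  show ?thesis
    using dim_eq_dim_kernel_plus_dim_image[OF linear_cross D2_subspace fK fI] unfolding dK dI by simp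
qed

end

section \<open>Multiderivations in three variables\<close>

lemma partial_superset:
  assumes "finite M" "keys f \<subseteq> M"
  shows "partial i f = (\<Sum>m\<in>M. Poly_Mapping.single (m - Poly_Mapping.single i 1)
       (of_nat (lookup m i) * lookup f m))"
  unfolding partial_def using assms
  by (intro sum.mono_neutral_left) (auto simp: not_in_keys_iff_lookup_eq_zero)

lemma partial_add: "partial i (f + g) = partial i f + partial i g"
proof -
  have "keys (f + g) \<subseteq> keys f \<union> keys g" by (rule keys_add)
  thus ?thesis
    by (simp add: partial_superset[of "keys f \<union> keys g"] lookup_add distrib_left single_add sum.distrib)
qed

lemma partial_sum: "partial i (\<Sum>j\<in>A. f j) = (\<Sum>j\<in>A. partial i (f j))"
proof (induction A rule: infinite_finite_induct)
  case (insert j A)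
  thus ?case by (simp add: partial_add)
qed (simp_all add: partial_def)

lemma partial_Const_Var: "partial j (Const c * Var i) = (if i = j then Const c else 0)"
proof -
  have "Const c * Var i = Poly_Mapping.single (Poly_Mapping.single i 1) c"
    by (simp add: Const_def Var_def mult_single)
  thus ?thesis
    by (simp add: partial_superset[of "{Poly_Mapping.single i 1}"] lookup_single when_def Const_def)
qed

lemma partial_linear_form: "partial i (linear_form a) = Const (a $ i)"
  by (simp add: linear_form_def partial_sum partial_Const_Var)

definition grad :: "(3, 'k::field) coord_ring \<Rightarrow> (3, 'k) coord_ring ^ 3" where
  "grad f = (\<chi> i. partial i f)"

lemma grad_nth [simp]: "grad f $ i = partial i f"
  by (simp add: grad_def)

lemma grad_linear_form: "grad (linear_form a) = cvec a"
  by (simp add: vec_eq_iff partial_linear_form)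

lemma permutations_lessThan_sums:
  fixes h :: "(nat \<Rightarrow> nat) \<Rightarrow> 'a::comm_ring_1"
  shows "sum h {\<pi>. \<pi> permutes {..<0}} = h id" "sum h {\<pi>. \<pi> permutes {..<1}} = h id"
    "sum h {\<pi>. \<pi> permutes {..<2}} = h id + h (Transposition.transpose 0 1)"
    "sum h {\<pi>. \<pi> permutes {..<3}} = h id + h (Transposition.transpose 1 2) + h (Transposition.transpose 0 1) +
       h (Transposition.transpose 0 1 \<circ> Transposition.transpose 1 2) + h (Transposition.transpose 0 2) + h (Transposition.transpose 0 2 \<circ> Transposition.transpose 1 2)"
proof -
  have *: "{..<1::nat} = {0}" "{..<2::nat} = insert 0 {1}" "{..<3::nat} = insert 0 (insert 1 {2})" by auto
  show "sum h {\<pi>. \<pi> permutes {..<0}} = h id" by simp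
  show "sum h {\<pi>. \<pi> permutes {..<1}} = h id" unfolding * by (simp add: permutes_sing)
  show "sum h {\<pi>. \<pi> permutes {..<2}} = h id + h (Transposition.transpose 0 1)"
    unfolding * by (subst sum_over_permutations_insert) (simp_all add: permutes_sing)
  show "sum h {\<pi>. \<pi> permutes {..<3}} = h id + h (Transposition.transpose 1 2) + h (Transposition.transpose 0 1) +
       h (Transposition.transpose 0 1 \<circ> Transposition.transpose 1 2) + h (Transposition.transpose 0 2) + h (Transposition.transpose 0 2 \<circ> Transposition.transpose 1 2)"
    unfolding * by (subst sum_over_permutations_insert, simp, simp, subst sum_over_permutations_insert)
      (simp_all add: permutes_sing add.assoc sum.distrib)
qed

lemma wedge_0: "wedge 0 \<delta> f = 1"
  unfolding wedge_def permutations_lessThan_sums by simp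

lemma wedge_1: "wedge 1 \<delta> f = \<delta> 0 (f 0)"
  unfolding wedge_def permutations_lessThan_sums by simp

lemma wedge_2: "wedge 2 \<delta> f = \<delta> 0 (f 0) * \<delta> 1 (f 1) - \<delta> 0 (f 1) * \<delta> 1 (f 0)"
  unfolding wedge_def permutations_lessThan_sums
  by (simp add: sign_swap_id numeral_2_eq_2 Transposition.transpose_def)

lemma wedge_3:
  fixes f :: "nat \<Rightarrow> ('n, 'k::field) coord_ring"
  shows "wedge 3 \<delta> f =
    \<delta> 0 (f 0) * \<delta> 1 (f 1) * \<delta> 2 (f 2) - \<delta> 0 (f 0) * \<delta> 1 (f 2) * \<delta> 2 (f 1)
  - \<delta> 0 (f 1) * \<delta> 1 (f 0) * \<delta> 2 (f 2) + \<delta> 0 (f 1) * \<delta> 1 (f 2) * \<delta> 2 (f 0)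
  - \<delta> 0 (f 2) * \<delta> 1 (f 1) * \<delta> 2 (f 0) + \<delta> 0 (f 2) * \<delta> 1 (f 0) * \<delta> 2 (f 1)"
proof -
  have three: "(\<Prod>i<3. h i) = h 0 * h 1 * h (2::nat)" for h :: "nat \<Rightarrow> ('n, 'k) coord_ring"
    by (simp add: eval_nat_numeral lessThan_Suc mult.commute)
  have s: "sign (Transposition.transpose 0 1 \<circ> Transposition.transpose 1 (2::nat)) = 1" "sign (Transposition.transpose 0 2 \<circ> Transposition.transpose 1 (2::nat)) = 1"
    by (simp_all add: sign_compose permutation_swap_id sign_swap_id)
  show ?thesis
    unfolding wedge_def permutations_lessThan_sums three s
    by (simp add: sign_swap_id Transposition.transpose_def)
qed

text \<open>With two arguments the vector product of the gradients makes the coefficient of a multiderivation a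
  vector again; with three arguments the determinant of the gradients leaves a single polynomial.\<close>

definition mder0 :: "(3, 'k::field) coord_ring \<Rightarrow> (3, 'k) multimap" where
  "mder0 h = (\<lambda>f. h)"

definition mder1 :: "(3, 'k::field) coord_ring ^ 3 \<Rightarrow> (3, 'k) multimap" where
  "mder1 g = (\<lambda>f. dot g (grad (f 0)))"

definition mder2 :: "(3, 'k::field) coord_ring ^ 3 \<Rightarrow> (3, 'k) multimap" where
  "mder2 g = (\<lambda>f. dot g (cross (grad (f 0)) (grad (f 1))))"

definition mder3 :: "(3, 'k::field) coord_ring \<Rightarrow> (3, 'k) multimap" where
  "mder3 h = (\<lambda>f. h * dot (grad (f 0)) (cross (grad (f 1)) (grad (f 2))))"

lemma linear_mder:
  "Vector_Spaces.linear fscale kscale mder0" "Vector_Spaces.linear vscale kscale mder1"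
  "Vector_Spaces.linear vscale kscale mder2" "Vector_Spaces.linear fscale kscale mder3"
  by (simp_all add: Vector_Spaces.linear_iff fscale_def vscale_def kscale_def sscale_def
      fvec.vector_space_axioms vvec.vector_space_axioms kvec.vector_space_axioms fun_eq_iff
      mder0_def mder1_def mder2_def mder3_def dot_linear distrib_right mult.assoc)

lemma grad_Var: "grad (Var i :: (3, 'k::field) coord_ring) = axis i 1"
proof -
  have "partial j (Var i :: (3, 'k) coord_ring) = (if i = j then 1 else 0)" for j
    using partial_Const_Var[of j "1 :: 'k" i] by (simp split: if_splits)
  thus ?thesis by (auto simp: vec_eq_iff axis_def)
qed

lemma dot_axis: "dot g (axis i 1) = g $ i"
  using exhaust_3[of i] by (auto simp: dot_def axis_def)

lemma cross_axis:
  "cross (axis 2 1) (axis 3 1) = (axis 1 1 :: 'a::comm_ring_1 ^ 3)"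
  "cross (axis 3 1) (axis 1 1) = (axis 2 1 :: 'a::comm_ring_1 ^ 3)"
  "cross (axis 1 1) (axis 2 1) = (axis 3 1 :: 'a::comm_ring_1 ^ 3)"
  by (simp_all add: vec3_eq_iff axis_def)

lemma cross_axis_exists: "\<exists>j k. cross (axis j 1) (axis k 1) = (axis i 1 :: 'a::comm_ring_1 ^ 3)"
  using exhaust_3[of i] cross_axis by metis

lemma mder_inj:
  "mder0 h = 0 \<Longrightarrow> h = 0" "mder1 g = 0 \<Longrightarrow> g = 0" "mder2 g = 0 \<Longrightarrow> g = 0" "mder3 h = 0 \<Longrightarrow> h = 0"
proof -
  show "mder0 h = 0 \<Longrightarrow> h = 0" by (simp add: mder0_def fun_eq_iff)
  show "g = 0" if "mder1 g = 0"
  proof (rule vec_eq_iff[THEN iffD2], rule allI)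
    fix i
    have "mder1 g (\<lambda>_. Var i) = 0" using that by simp
    thus "g $ i = 0 $ i" by (simp add: mder1_def grad_Var dot_axis)
  qed
  show "g = 0" if "mder2 g = 0"
  proof (rule vec_eq_iff[THEN iffD2], rule allI)
    fix i
    obtain j k where jk: "cross (axis j 1) (axis k 1) = (axis i 1 :: (3, 'b) coord_ring ^ 3)"
      using cross_axis_exists by metis
    have "mder2 g (\<lambda>n. if n = 0 then Var j else Var k) = 0" using that by simp
    thus "g $ i = 0 $ i" by (simp add: mder2_def grad_Var jk dot_axis)
  qed
  show "h = 0" if "mder3 h = 0"
  proof -
    have "mder3 h (\<lambda>n. if n = 0 then Var 1 else if n = 1 then Var 2 else Var 3) = 0" using that by simp
    thus "h = 0" by (simp add: mder3_def grad_Var cross_axis dot_axis)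
  qed
qed

lemma partial_in_Der: "partial i \<in> (Der :: (('n::finite, 'k::field) coord_ring \<Rightarrow> _) set)"
proof -
  have "partial i f = (\<Sum>j\<in>UNIV. (if j = i then 1 else 0) * partial j f)" for f :: "('n, 'k) coord_ring"
    by (simp add: if_distrib[of "\<lambda>x. x * _"] cong: if_cong)
  hence "partial i = (\<lambda>f :: ('n, 'k) coord_ring. \<Sum>j\<in>UNIV. (if j = i then 1 else 0) * partial j f)"
    by (rule ext)
  thus ?thesis unfolding Der_def mem_Collect_eq by (intro exI[of _ "\<lambda>j. if j = i then 1 else 0"] conjI TrueI)
qed

lemma ext_Der_degree_subset: "ext_Der_degree p k \<subseteq> ext_Der p"
proof -
  have sub: "kvec.subspace (ext_Der p)"
    unfolding kvec.subspace_def ext_Der_def kscale_def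
    by (auto intro: smod.span_zero smod.span_add smod.span_scale)
  show ?thesis unfolding ext_Der_degree_def
  proof (rule kvec.span_minimal[OF _ sub], safe)
    fix g :: "('a, 'b) coord_ring" and c
    show "sscale g (wedge p (\<lambda>i. partial (c i))) \<in> ext_Der p"
      unfolding ext_Der_def using partial_in_Der by (intro smod.span_scale smod.span_base) blast
  qed
qed

text \<open>The generators are multiples of wedge products of partial derivatives, so it suffices to express
  these by coefficient vectors.\<close>

lemma ext_Der_degree_eqI:
  assumes sub: "kvec.subspace W"
    and gen: "\<And>g c. g \<in> forms (int k) \<Longrightarrow> sscale g (wedge p (\<lambda>i. partial (c i))) \<in> W"
    and W: "W \<subseteq> ext_Der_degree p k"
  shows "ext_Der_degree p k = W"
proof (rule subset_antisym[OF _ W])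
  show "ext_Der_degree p k \<subseteq> W" unfolding ext_Der_degree_def
    by (rule kvec.span_minimal[OF _ sub]) (auto simp: homogeneous_iff_forms gen)
qed

lemma ext_Der_degree_gen:
  "g \<in> forms (int k) \<Longrightarrow> sscale g (wedge p (\<lambda>i. partial (c i))) \<in> ext_Der_degree p k"
  unfolding ext_Der_degree_def by (intro kvec.span_base) (auto simp: homogeneous_iff_forms)

definition vforms :: "int \<Rightarrow> ((3, 'k::field) coord_ring ^ 3) set" where
  "vforms d = {g. \<forall>i. g $ i \<in> forms d}"

lemma vforms_subspace: "vvec.subspace (vforms d)"
  by (auto simp: vvec.subspace_def vscale_def vforms_def intro: forms_add forms_Const_mult)

lemma vforms_cvec: "f \<in> forms d \<Longrightarrow> f *s cvec v \<in> vforms d"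
  using forms_mult[of f d "Const _" 0] by (simp add: vforms_def)

lemma ext_Der_degree_0:
  "ext_Der_degree 0 k = (mder0 ` forms (int k) :: (3, 'k::field) multimap set)"
proof (rule ext_Der_degree_eqI)
  interpret Vector_Spaces.linear fscale kscale mder0 by (rule linear_mder)
  show "kvec.subspace (mder0 ` forms (int k) :: (3, 'k) multimap set)" by (rule subspace_image[OF forms_subspace])
  have *: "sscale g (wedge 0 \<delta>) = mder0 g" for g :: "(3, 'k) coord_ring" and \<delta>
    by (simp add: fun_eq_iff sscale_def wedge_0 mder0_def)
  show "mder0 ` forms (int k) \<subseteq> (ext_Der_degree 0 k :: (3, 'k) multimap set)"
  proof safe
    fix g :: "(3, 'k) coord_ring" assume "g \<in> forms (int k)"
    hence "sscale g (wedge 0 (\<lambda>_. partial 1)) \<in> ext_Der_degree 0 k" by (rule ext_Der_degree_gen)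
    thus "mder0 g \<in> ext_Der_degree 0 k" unfolding * .
  qed
  show "sscale g (wedge 0 (\<lambda>i. partial (c i))) \<in> mder0 ` forms (int k)" if "g \<in> forms (int k)" for g :: "(3, 'k) coord_ring" and c
    using that unfolding * by blast
qed

lemma ext_Der_degree_1:
  "ext_Der_degree 1 k = (mder1 ` vforms (int k) :: (3, 'k::field) multimap set)"
proof (rule ext_Der_degree_eqI)
  interpret Vector_Spaces.linear vscale kscale mder1 by (rule linear_mder)
  show "kvec.subspace (mder1 ` vforms (int k) :: (3, 'k) multimap set)" by (rule subspace_image[OF vforms_subspace])
  have *: "sscale g (wedge 1 (\<lambda>i. partial (c i))) = mder1 (g *s cvec (axis (c 0) 1))"
    for g :: "(3, 'k) coord_ring" and c
    using exhaust_3[of "c 0"]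
    by (auto simp: fun_eq_iff sscale_def wedge_1 mder1_def dot_def axis_def simp del: One_nat_def)
  show "sscale g (wedge 1 (\<lambda>i. partial (c i))) \<in> mder1 ` vforms (int k)" if "g \<in> forms (int k)" for g :: "(3, 'k) coord_ring" and c
    using vforms_cvec[OF that] unfolding * by blast
  show "mder1 ` vforms (int k) \<subseteq> (ext_Der_degree 1 k :: (3, 'k) multimap set)"
  proof safe
    fix g :: "(3, 'k) coord_ring ^ 3" assume "g \<in> vforms (int k)"
    hence "sscale (g $ i) (wedge 1 (\<lambda>_. partial i)) \<in> ext_Der_degree 1 k" for i
      by (intro ext_Der_degree_gen) (simp add: vforms_def)
    moreover have "mder1 g = sscale (g $ 1) (wedge 1 (\<lambda>_. partial 1)) + sscale (g $ 2) (wedge 1 (\<lambda>_. partial 2))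
        + sscale (g $ 3) (wedge 1 (\<lambda>_. partial 3))"
      by (simp add: fun_eq_iff sscale_def wedge_1 mder1_def dot_def del: One_nat_def)
    ultimately show "mder1 g \<in> ext_Der_degree 1 k"
      unfolding ext_Der_degree_def by (simp only: kvec.span_add)
  qed
qed

lemma dot_cross_cross: "dot (cross u v) (cross x y) = dot u x * dot v y - dot u y * dot v x"
  by (simp add: dot_def algebra_simps)

lemma sscale_wedge_2:
  "sscale g (wedge 2 (\<lambda>i. partial (c i))) = mder2 (g *s cvec (cross (axis (c 0) 1) (axis (c 1) 1)))"
  for g :: "(3, 'k::field) coord_ring"
proof -
  have cv: "cvec (axis i 1) = (axis i 1 :: (3, 'k) coord_ring ^ 3)" for i
    by (auto simp: vec_eq_iff axis_def)
  show ?thesis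
    unfolding fun_eq_iff sscale_def wedge_2 mder2_def cross_cvec[symmetric] cv dot_linear dot_cross_cross
    by (simp add: dot_commute[of "axis _ 1"] dot_axis)
qed

lemma ext_Der_degree_2:
  "ext_Der_degree 2 k = (mder2 ` vforms (int k) :: (3, 'k::field) multimap set)"
proof (rule ext_Der_degree_eqI)
  interpret Vector_Spaces.linear vscale kscale mder2 by (rule linear_mder)
  show "kvec.subspace (mder2 ` vforms (int k) :: (3, 'k) multimap set)" by (rule subspace_image[OF vforms_subspace])
  show "sscale g (wedge 2 (\<lambda>i. partial (c i))) \<in> mder2 ` vforms (int k)" if "g \<in> forms (int k)" for g :: "(3, 'k) coord_ring" and c
    using vforms_cvec[OF that] unfolding sscale_wedge_2 by blast
  show "mder2 ` vforms (int k) \<subseteq> (ext_Der_degree 2 k :: (3, 'k) multimap set)"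
  proof safe
    fix g :: "(3, 'k) coord_ring ^ 3" assume g: "g \<in> vforms (int k)"
    have *: "mder2 (g $ i *s cvec (axis i 1)) \<in> ext_Der_degree 2 k" for i
    proof -
      obtain j l where jl: "cross (axis j 1) (axis l 1) = (axis i 1 :: 'k ^ 3)"
        using cross_axis_exists by metis
      have "sscale (g $ i) (wedge 2 (\<lambda>n. partial (if n = 0 then j else l))) \<in> ext_Der_degree 2 k"
        using g by (intro ext_Der_degree_gen) (simp add: vforms_def)
      thus ?thesis unfolding sscale_wedge_2 by (simp add: jl)
    qed
    have "g = g $ 1 *s cvec (axis 1 1) + g $ 2 *s cvec (axis 2 1) + g $ 3 *s cvec (axis 3 1)"
      by (simp add: vec3_eq_iff axis_def)
    hence "mder2 g = mder2 (g $ 1 *s cvec (axis 1 1)) + mder2 (g $ 2 *s cvec (axis 2 1))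
        + mder2 (g $ 3 *s cvec (axis 3 1))"
      by (metis add)
    thus "mder2 g \<in> ext_Der_degree 2 k"
      using * unfolding ext_Der_degree_def by (simp only: kvec.span_add)
  qed
qed

lemma coordinate_determinant:
  fixes x y z :: "'a::comm_ring_1 ^ 3"
  shows "x $ i * y $ j * z $ k - x $ i * z $ j * y $ k - y $ i * x $ j * z $ k + y $ i * z $ j * x $ k
     - z $ i * y $ j * x $ k + z $ i * x $ j * y $ k =
     dot (axis i 1) (cross (axis j 1) (axis k 1)) * dot x (cross y z)"
  using exhaust_3[of i] exhaust_3[of j] exhaust_3[of k]
  by (elim disjE) (simp_all add: dot_def axis_def algebra_simps)

lemma sscale_wedge_3:
  "sscale g (wedge 3 (\<lambda>i. partial (c i))) =
     mder3 (Const (dot (axis (c 0) 1) (cross (axis (c 1) 1) (axis (c 2) 1))) * g)"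
  for g :: "(3, 'k::field) coord_ring"
proof -
  have cv: "cvec (axis i 1) = (axis i 1 :: (3, 'k) coord_ring ^ 3)" for i
    by (auto simp: vec_eq_iff axis_def)
  show ?thesis
  proof (rule ext)
    fix f :: "nat \<Rightarrow> (3, 'k) coord_ring"
    let ?D = "dot (grad (f 0)) (cross (grad (f 1)) (grad (f 2)))"
    have "wedge 3 (\<lambda>i. partial (c i)) f =
        dot (axis (c 0) 1) (cross (axis (c 1) 1) (axis (c 2) 1)) * ?D"
      unfolding wedge_3
      using coordinate_determinant[of "grad (f 0)" "c 0" "grad (f 1)" "c 1" "grad (f 2)" "c 2"]
      by (simp only: grad_nth)
    also have "(dot (axis (c 0) 1) (cross (axis (c 1) 1) (axis (c 2) 1)) :: (3, 'k) coord_ring) =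
        Const (dot (axis (c 0) 1) (cross (axis (c 1) 1) (axis (c 2) 1)))"
      by (simp only: dot_cvec[symmetric] cross_cvec[symmetric] cv)
    finally show "sscale g (wedge 3 (\<lambda>i. partial (c i))) f =
        mder3 (Const (dot (axis (c 0) 1) (cross (axis (c 1) 1) (axis (c 2) 1))) * g) f"
      by (simp only: sscale_def mder3_def mult.assoc mult.left_commute)
  qed
qed

lemma ext_Der_degree_3:
  "ext_Der_degree 3 k = (mder3 ` forms (int k) :: (3, 'k::field) multimap set)"
proof (rule ext_Der_degree_eqI)
  interpret Vector_Spaces.linear fscale kscale mder3 by (rule linear_mder)
  show "kvec.subspace (mder3 ` forms (int k) :: (3, 'k) multimap set)" by (rule subspace_image[OF forms_subspace])
  show "sscale g (wedge 3 (\<lambda>i. partial (c i))) \<in> mder3 ` forms (int k)" if "g \<in> forms (int k)" for g :: "(3, 'k) coord_ring" and c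
    using forms_Const_mult[OF that] unfolding sscale_wedge_3 by blast
  show "mder3 ` forms (int k) \<subseteq> (ext_Der_degree 3 k :: (3, 'k) multimap set)"
  proof safe
    fix g :: "(3, 'k) coord_ring" assume "g \<in> forms (int k)"
    hence "sscale g (wedge 3 (\<lambda>n. partial (if n = 0 then 1 else if n = 1 then 2 else 3))) \<in> ext_Der_degree 3 k"
      by (rule ext_Der_degree_gen)
    thus "mder3 g \<in> ext_Der_degree 3 k"
      unfolding sscale_wedge_3 by (simp add: cross_axis dot_axis)
  qed
qed

lemma log_Der_degree:
  "log_Der \<A> \<alpha> p \<inter> ext_Der_degree p k = {\<theta> \<in> ext_Der_degree p k. p > 0 \<longrightarrow>
     (\<forall>H\<in>\<A>. \<forall>f. f 0 = linear_form (\<alpha> H) \<longrightarrow> linear_form (\<alpha> H) dvd \<theta> f)}"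
  using ext_Der_degree_subset[of p k] unfolding log_Der_def by blast

lemma log_Der_degree_0: "log_Der \<A> \<alpha> 0 \<inter> ext_Der_degree 0 k = mder0 ` forms (int k)"
  unfolding log_Der_degree unfolding ext_Der_degree_0 by simp

lemma log_Der_degree_1: "log_Der \<A> \<alpha> 1 \<inter> ext_Der_degree 1 k = mder1 ` D1 (\<alpha> ` \<A>) (int k)"
proof -
  have "(\<forall>f. f 0 = linear_form b \<longrightarrow> linear_form b dvd mder1 g f) \<longleftrightarrow> linear_form b dvd dot (cvec b) g" for b g
    unfolding mder1_def by (auto simp: grad_linear_form dot_commute[of g])
  thus ?thesis
    unfolding log_Der_degree unfolding ext_Der_degree_1 D1_def vforms_def by auto
qed

text \<open>Inserting the form of \<open>b\<close> as first argument leaves a derivation with coefficient vector \<open>g \<times> b\<close> in the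
  second; it is tested on the variables.\<close>

lemma log_Der_degree_2: "log_Der \<A> \<alpha> 2 \<inter> ext_Der_degree 2 k = mder2 ` D2 (\<alpha> ` \<A>) (int k)"
proof -
  have *: "mder2 g f = dot (grad (f 1)) (cross g (cvec b))" if "f 0 = linear_form b" for f b g
    unfolding mder2_def that grad_linear_form by (metis dot_cross_rotate)
  have iff: "(\<forall>f. f 0 = linear_form b \<longrightarrow> linear_form b dvd mder2 g f) \<longleftrightarrow>
      (\<forall>i. linear_form b dvd cross g (cvec b) $ i)" for b g
  proof (intro iffI allI impI)
    fix i
    let ?f = "\<lambda>n. if n = 0 then linear_form b else Var i"
    assume "\<forall>f. f 0 = linear_form b \<longrightarrow> linear_form b dvd mder2 g f"
    hence "linear_form b dvd mder2 g ?f" by simp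
    also have "mder2 g ?f = cross g (cvec b) $ i"
      by (subst *) (simp_all add: grad_Var dot_commute[of "axis i 1"] dot_axis del: cross_nth)
    finally show "linear_form b dvd cross g (cvec b) $ i" .
  next
    fix f :: "nat \<Rightarrow> (3, 'b) coord_ring"
    assume "\<forall>i. linear_form b dvd cross g (cvec b) $ i" "f 0 = linear_form b"
    thus "linear_form b dvd mder2 g f"
      unfolding *[of f b g, OF \<open>f 0 = linear_form b\<close>] dot_def by (intro dvd_add dvd_mult) blast+
  qed
  have "log_Der \<A> \<alpha> 2 \<inter> ext_Der_degree 2 k = mder2 ` {g \<in> vforms (int k).
      \<forall>H\<in>\<A>. \<forall>f. f 0 = linear_form (\<alpha> H) \<longrightarrow> linear_form (\<alpha> H) dvd mder2 g f}"
    unfolding log_Der_degree unfolding ext_Der_degree_2 by auto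
  also have "\<dots> = mder2 ` D2 (\<alpha> ` \<A>) (int k)"
    unfolding iff D2_def vforms_def by simp
  finally show ?thesis .
qed

lemma log_Der_degree_3:
  assumes nz: "\<And>H. H \<in> \<A> \<Longrightarrow> \<alpha> H \<noteq> 0"
  shows "log_Der \<A> \<alpha> 3 \<inter> ext_Der_degree 3 k = mder3 ` D3 (\<alpha> ` \<A>) (int k)"
proof -
  have "(\<forall>f. f 0 = linear_form b \<longrightarrow> linear_form b dvd mder3 h f) \<longleftrightarrow> linear_form b dvd h"
    if b: "b \<noteq> 0" for b h
  proof
    assume *: "\<forall>f. f 0 = linear_form b \<longrightarrow> linear_form b dvd mder3 h f"
    obtain i where i: "b $ i \<noteq> 0" using b by (auto simp: vec_eq_iff)
    obtain j l where jl: "cross (axis j 1) (axis l 1) = (axis i 1 :: (3, 'b) coord_ring ^ 3)"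
      using cross_axis_exists by metis
    let ?f = "\<lambda>n::nat. if n = 0 then linear_form b else if n = 1 then Var j else Var l"
    have "linear_form b dvd mder3 h ?f" using * by simp
    also have "mder3 h ?f = Const (b $ i) * h"
      by (simp add: mder3_def grad_linear_form grad_Var jl dot_axis)
    finally show "linear_form b dvd h" using dvd_Const_mult_iff[OF i] by blast
  next
    assume "linear_form b dvd h"
    thus "\<forall>f. f 0 = linear_form b \<longrightarrow> linear_form b dvd mder3 h f" by (simp add: mder3_def)
  qed
  thus ?thesis
    using nz unfolding log_Der_degree unfolding ext_Der_degree_3 D3_def by auto
qed

section \<open>The Solomon-Terao polynomial\<close>

lemma Hilb_log_Der_nth:
  fixes \<alpha> :: "('k::field ^ 3) set \<Rightarrow> 'k ^ 3"
  assumes nz: "\<And>H. H \<in> \<A> \<Longrightarrow> \<alpha> H \<noteq> 0"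
  shows "fps_nth (Hilb_log_Der \<A> \<alpha> 0) k = of_nat (fvec.dim (forms (int k) :: (3, 'k) coord_ring set))"
    and "fps_nth (Hilb_log_Der \<A> \<alpha> 1) k = of_nat (vvec.dim (D1 (\<alpha> ` \<A>) (int k)))"
    and "fps_nth (Hilb_log_Der \<A> \<alpha> 2) k = of_nat (vvec.dim (D2 (\<alpha> ` \<A>) (int k)))"
    and "fps_nth (Hilb_log_Der \<A> \<alpha> 3) k = of_nat (fvec.dim (D3 (\<alpha> ` \<A>) (int k)))"
proof -
  have L3: "log_Der \<A> \<alpha> 3 \<inter> ext_Der_degree 3 k = mder3 ` D3 (\<alpha> ` \<A>) (int k)"
    by (rule log_Der_degree_3) (rule nz)
  have "kvec.dim (mder0 ` forms d :: (3, 'k) multimap set) = fvec.dim (forms d :: (3, 'k) coord_ring set)"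
    "kvec.dim (mder1 ` D1 C d :: (3, 'k) multimap set) = vvec.dim (D1 C d)"
    "kvec.dim (mder2 ` D2 C d :: (3, 'k) multimap set) = vvec.dim (D2 C d)"
    "kvec.dim (mder3 ` D3 C d :: (3, 'k) multimap set) = fvec.dim (D3 C d)" for C d
    by (rule dim_image_inj_on[OF linear_mder(1) forms_subspace], erule mder_inj)
       (rule dim_image_inj_on[OF linear_mder(2) D1_subspace], erule mder_inj,
        rule dim_image_inj_on[OF linear_mder(3) D2_subspace], erule mder_inj,
        rule dim_image_inj_on[OF linear_mder(4) D3_subspace], erule mder_inj)
  thus "fps_nth (Hilb_log_Der \<A> \<alpha> 0) k = of_nat (fvec.dim (forms (int k) :: (3, 'k) coord_ring set))"
    "fps_nth (Hilb_log_Der \<A> \<alpha> 1) k = of_nat (vvec.dim (D1 (\<alpha> ` \<A>) (int k)))"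
    "fps_nth (Hilb_log_Der \<A> \<alpha> 2) k = of_nat (vvec.dim (D2 (\<alpha> ` \<A>) (int k)))"
    "fps_nth (Hilb_log_Der \<A> \<alpha> 3) k = of_nat (fvec.dim (D3 (\<alpha> ` \<A>) (int k)))"
    unfolding Hilb_log_Der_def Hilb_def fps_nth_Abs_fps log_Der_degree_0 log_Der_degree_1
      log_Der_degree_2 L3 by simp_all
qed

context plane_vectors
begin

text \<open>The coefficients of \<open>s - x u + x^(n + 1) s\<close>, where \<open>s\<close> and \<open>u\<close> are the Hilbert series of the
  polynomial ring and of \<open>D0\<close>, and \<open>n = card F + 1\<close>.\<close>

definition G :: "int \<Rightarrow> int" where
  "G k = int (fvec.dim (forms k :: (3, 'k) coord_ring set)) - int (vvec.dim (D0 a0 F (k - 1))) +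
     int (fvec.dim (forms (k - 2 - int (card F)) :: (3, 'k) coord_ring set))"

text \<open>For \<open>k \<ge> card F\<close> all three dimensions are given by quadratic polynomials in \<open>k\<close>, whose
  non-constant terms cancel. At \<open>k = card F - 1\<close> the last dimension, for degree \<open>- 3\<close>, is 0, whereas
  its polynomial has the value 1.\<close>

lemma G_eventually_constant:
  "\<exists>\<gamma>. (\<forall>k \<ge> int (card F). G k = \<gamma>) \<and> G (int (card F) - 1) = \<gamma> - 1"
proof -
  let ?s = "\<lambda>d. int (fvec.dim (forms d :: (3, 'k) coord_ring set))"
  let ?N = "int (card F)"
  obtain c where c: "int (vvec.dim (D0 a0 F d)) = (d + 1) * (d + 2) - ?N * (d + 1) + c"
    if "d + 2 \<ge> ?N" for d
    using dim_D0[OF a0_nonzero finite_F a0_F pairwise_F] by blast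
  have u: "int (vvec.dim (D0 a0 F (k - 1))) = k * (k + 1) - ?N * k + c" if "k \<ge> ?N - 1" for k
    using c[of "k - 1"] that by (simp add: algebra_simps)
  have s: "2 * ?s d = (d + 1) * (d + 2)" if "d \<ge> -2" for d using dim_forms[OF that] .
  have N0: "?N \<ge> 0" by simp
  have G1: "2 * G k = 2 - 2 * c + ?N * (?N + 1)" if k: "k \<ge> ?N" for k
  proof -
    have "2 * G k = 2 * ?s k - 2 * (k * (k + 1) - ?N * k + c) + 2 * ?s (k - 2 - ?N)"
      using k u[of k] by (simp add: G_def)
    also have "\<dots> = (k + 1) * (k + 2) - 2 * (k * (k + 1) - ?N * k + c) + (k - 2 - ?N + 1) * (k - 2 - ?N + 2)"
      using s[of k] s[of "k - 2 - ?N"] k N0 by simp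
    also have "\<dots> = 2 - 2 * c + ?N * (?N + 1)" by (simp add: algebra_simps)
    finally show ?thesis .
  qed
  have "2 * G (?N - 1) = 2 * ?s (?N - 1) - 2 * ((?N - 1) * ?N - ?N * (?N - 1) + c)"
    using u[of "?N - 1"] by (simp add: G_def dim_forms_negative)
  also have "\<dots> = ?N * (?N + 1) - 2 * c" using s[of "?N - 1"] N0 by (simp add: algebra_simps)
  finally have G2: "2 * G (?N - 1) = ?N * (?N + 1) - 2 * c" .
  have "G k = G ?N" if "k \<ge> ?N" for k using G1[OF that] G1[of ?N] by simp
  moreover have "G (?N - 1) = G ?N - 1" using G1[of ?N] G2 by simp
  ultimately show ?thesis by blast
qed

end

text \<open>By the splittings of the modules each of the series \<open>s\<close>, \<open>x u\<close> and \<open>x^(n + 1) s\<close> occurs twice, with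
  opposite signs and shifted by two degrees.\<close>

lemma Solomon_Terao_nth:
  fixes \<A> :: "('k::field ^ 3) set set" and \<alpha> :: "('k ^ 3) set \<Rightarrow> 'k ^ 3"
  assumes "plane_vectors a0 F" and \<alpha>: "\<alpha> ` \<A> = insert a0 F"
  shows "fps_nth (Solomon_Terao \<A> \<alpha>) k =
    of_int (plane_vectors.G a0 F (int k) - plane_vectors.G a0 F (int k - 2))"
proof -
  interpret plane_vectors a0 F by fact
  have nz: "\<alpha> H \<noteq> 0" if "H \<in> \<A>" for H
  proof -
    have "\<alpha> H \<in> insert a0 F" using that \<alpha> by blast
    thus ?thesis using a0_nonzero F_nonzero by blast
  qed
  let ?s = "\<lambda>d. int (fvec.dim (forms d :: (3, 'k) coord_ring set))"
  let ?u = "\<lambda>d. int (vvec.dim (D0 a0 F d))"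
  let ?N = "int (card F)"
  have z: "?s d = 0" "?u d = 0" if "d < 0" for d
    using that by (simp_all add: dim_forms_negative D0_negative vvec.dim_zero)
  have H: "fps_nth (Hilb_log_Der \<A> \<alpha> 0) k = of_int (?s (int k))"
    "fps_nth (Hilb_log_Der \<A> \<alpha> 1) k = of_int (?s (int k - 1) + ?u (int k))"
    "fps_nth (Hilb_log_Der \<A> \<alpha> 2) k = of_int (?u (int k - 1) + ?s (int k - ?N))"
    "fps_nth (Hilb_log_Der \<A> \<alpha> 3) k = of_int (?s (int k - ?N - 1))" for k
    using Hilb_log_Der_nth[of \<A> \<alpha> k, OF nz] by (simp_all add: \<alpha> dim_D1 dim_D2 dim_D3)
  have e: "{..CARD(3)} = {0, 1, 2, 3::nat}" by auto
  have "Solomon_Terao \<A> \<alpha> = Hilb_log_Der \<A> \<alpha> 0 - Hilb_log_Der \<A> \<alpha> 1 * fps_X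
      + Hilb_log_Der \<A> \<alpha> 2 * fps_X ^ 2 - Hilb_log_Der \<A> \<alpha> 3 * fps_X ^ 3"
    unfolding Solomon_Terao_eq e by (simp add: eval_nat_numeral)
  hence "fps_nth (Solomon_Terao \<A> \<alpha>) k = of_int (?s (int k)
      - (if k < 1 then 0 else ?s (int (k - 1) - 1) + ?u (int (k - 1)))
      + (if k < 2 then 0 else ?u (int (k - 2) - 1) + ?s (int (k - 2) - ?N))
      - (if k < 3 then 0 else ?s (int (k - 3) - ?N - 1)))"
    using H by (simp add: fps_X_power_mult_right_nth)
  also have "(if k < 1 then 0 else ?s (int (k - 1) - 1) + ?u (int (k - 1))) =
      ?s (int k - 2) + ?u (int k - 1)"
    using z[of "int k - 2"] z[of "int k - 1"] by (auto simp: of_nat_diff)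
  also have "(if k < 2 then 0 else ?u (int (k - 2) - 1) + ?s (int (k - 2) - ?N)) =
      ?u (int k - 3) + ?s (int k - 2 - ?N)"
    using z[of "int k - 3"] z[of "int k - 2 - ?N"] by (auto simp: of_nat_diff)
  also have "(if k < 3 then 0 else ?s (int (k - 3) - ?N - 1)) = ?s (int k - 4 - ?N)"
    using z[of "int k - 4 - ?N"] by (auto simp: of_nat_diff algebra_simps)
  also have "?s (int k) - (?s (int k - 2) + ?u (int k - 1)) + (?u (int k - 3) + ?s (int k - 2 - ?N))
      - ?s (int k - 4 - ?N) = G (int k) - G (int k - 2)"
    by (simp add: G_def algebra_simps)
  finally show ?thesis .
qed

lemma fps_is_monic_poly:
  fixes f :: "'a::comm_ring_1 fps"
  assumes "\<And>k. k > n \<Longrightarrow> fps_nth f k = 0" "fps_nth f n = 1"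
  shows "\<exists>P. fps_of_poly P = f \<and> degree P = n \<and> lead_coeff P = 1"
proof -
  define P where "P = (\<Sum>i\<le>n. monom (fps_nth f i) i)"
  have P: "coeff P i = fps_nth f i" for i using assms(1)[of i] by (auto simp: P_def coeff_sum)
  have "degree P = n"
  proof (rule antisym)
    show "degree P \<le> n" by (rule degree_le) (simp add: P assms(1))
    show "n \<le> degree P" by (rule le_degree) (simp add: P assms(2))
  qed
  moreover have "fps_of_poly P = f" by (rule fps_ext) (simp add: P)
  ultimately show ?thesis using P[of n] assms(2) by auto
qed

lemma form_kernel_eq_dot: "form_kernel a = {v. dot a v = 0}"
  by (simp add: form_kernel_def sum_3 dot_def)

theorem corollary1p8:
  fixes \<A> :: "('k::field ^ 3) set set"
    and \<alpha> :: "('k ^ 3) set \<Rightarrow> 'k ^ 3"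
  assumes "arrangement_in UNIV \<A>"
    and "irreducible_arrangement \<A>"
    and "\<And>H. H \<in> \<A> \<Longrightarrow> form_kernel (\<alpha> H) = H"
  shows "\<exists>P :: rat poly. fps_of_poly P = Solomon_Terao \<A> \<alpha> \<and>
           degree P = card \<A> \<and> lead_coeff P = 1"
proof -
  have ne: "\<A> \<noteq> {}" using assms(2) by (simp add: irreducible_arrangement_def)
  then obtain H0 where H0: "H0 \<in> \<A>" by blast
  have fin: "finite \<A>" using assms(1) by (simp add: arrangement_in_def)
  have nz: "\<alpha> H \<noteq> 0" if "H \<in> \<A>" for H
  proof
    assume "\<alpha> H = 0"
    hence "H = UNIV" using assms(3)[OF that] by (auto simp: form_kernel_eq_dot dot_linear)
    thus False using assms(1) that by (auto simp: arrangement_in_def hyperplane_in_def)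
  qed
  have cross: "cross (\<alpha> H) (\<alpha> H') \<noteq> 0" if H: "H \<in> \<A>" "H' \<in> \<A>" "H \<noteq> H'" for H H'
  proof
    assume "cross (\<alpha> H) (\<alpha> H') = 0"
    then obtain c where c: "\<alpha> H = c *s \<alpha> H'"
      using proportional_if_cross_zero nz[OF H(2)] by blast
    have "c \<noteq> 0" using c nz[OF H(1)] by auto
    hence "form_kernel (\<alpha> H) = form_kernel (\<alpha> H')" by (simp add: c form_kernel_eq_dot dot_linear)
    thus False using assms(3) H by simp
  qed
  have inj: "inj_on \<alpha> \<A>" using assms(3) by (metis inj_onI)
  define F where "F = \<alpha> ` (\<A> - {H0})"
  have card_F: "card \<A> = card F + 1"
    using card_image[OF inj_on_subset[OF inj], of "\<A> - {H0}"] card.remove[OF fin H0] by (simp add: F_def)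
  have pv: "plane_vectors (\<alpha> H0) F"
    using fin nz[OF H0] cross H0 by unfold_locales (auto simp: F_def)
  have im: "\<alpha> ` \<A> = insert (\<alpha> H0) F" using H0 by (auto simp: F_def)
  interpret plane_vectors "\<alpha> H0" F by (rule pv)
  obtain \<gamma> where \<gamma>: "\<And>k. k \<ge> int (card F) \<Longrightarrow> G k = \<gamma>" "G (int (card F) - 1) = \<gamma> - 1"
    using G_eventually_constant by blast
  note ST = Solomon_Terao_nth[OF pv im]
  show ?thesis
  proof (rule fps_is_monic_poly)
    show "fps_nth (Solomon_Terao \<A> \<alpha>) k = 0" if "k > card \<A>" for k
      using that card_F by (simp add: ST \<gamma>)
    \<comment> \<open>Here the last difference is \<open>\<gamma> - (\<gamma> - 1)\<close>.\<close>
    have "int (card \<A>) - 2 = int (card F) - 1" using card_F by simp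
    thus "fps_nth (Solomon_Terao \<A> \<alpha>) (card \<A>) = 1"
      using card_F by (simp add: ST \<gamma>)
  qed
qed

end
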